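(* Let $\mathbb P$ and $\mathbb K$ be Banach spaces with monotone finite-dimensional decompositions, both satisfying the extension property (E) defined in the context. Let $A\subseteq\mathbb P$ and $B\subseteq\mathbb K$ be finite-dimensional subspaces that are $1$-complemented in $\mathbb P$ and $\mathbb K$, respectively, and let $h\colon A\to B$ be a bijective linear isometry. Then for every $\varepsilon>0$ there exists a bijective linear isometry $H\colon\mathbb P\to\mathbb K$ that is $\varepsilon$-close to $h$, i.e. $\|H\restriction A-h\|\le\varepsilon$. In particular, $\mathbb P$ and $\mathbb K$ are linearly isometric.
   Context: All Banach spaces are real. An operator is $1$-bounded if it is linear of norm at most $1$. A subspace $Y$ of a Banach space $X$ is $1$-complemented in $X$ if there is a projection $P\colon X\to Y$ (so $Py=y$ for $y\in Y$) with $\|P\|\le 1$. For $\varepsilon>0$, $Y\subseteq X$ is $(1,\varepsilon)$-complemented in $X$ if there is a $1$-bounded operator $T\colon X\to Y$ with $\|Ty-y\|\le\varepsilon\|y\|$ for every $y\in Y$. For $\varepsilon>0$, an $\varepsilon$-isometric embedding (or $\varepsilon$-isometry) is a linear operator $f\colon X\to Y$ with $(1-\varepsilon)\|x\|\le\|f(x)\|\le\|x\|$ for all $x\in X$. Monotone FDD: a finite-dimensional decomposition (FDD, also called Schauder decomposition) of a Banach space $X$ is a sequence of finite-rank, pairwise orthogonal bounded linear operators $P_n\colon X\to X$ such that $x=\sum_{n=0}^\infty P_nx$ for every $x\in X$. It is monotone if the projections $Q_n=P_0+\dots+P_{n-1}$ satisfy $\sup_n\|Q_n\|\le 1$. Equivalently,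 there are finite-rank projections $Q_n$ of norm $\le 1$ converging pointwise to the identity with $Q_nQ_m=Q_{\min(n,m)}$ for all $n,m$. Property (E) of a Banach space $X$: given a pair $E\subseteq F$ of finite-dimensional Banach spaces such that $E$ is $1$-complemented in $F$, and given a linear isometric embedding $i\colon E\to X$ such that $i[E]$ is $1$-complemented in $X$, for every $\varepsilon>0$ there exists an $\varepsilon$-isometric embedding $g\colon F\to X$ such that $\|g\restriction E-i\|<\varepsilon$ and $g[F]$ is $(1,\varepsilon)$-complemented in $X$. *)

theory Defs
  imports "HOL-Analysis.Analysis" "HOL-Analysis.Finite_Function_Topology"
begin

section \<open>Normed spaces on a carrier\<close>

text \<open>
  Property (E) below quantifies over all finite-dimensional Banach spaces, which types cannot do
  inside a formula. A normed space is therefore also given by a pair \<open>(V, N)\<close> of a linear subspace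
  \<open>V\<close> of some real vector space and a norm \<open>N\<close> on \<open>V\<close>; the values of \<open>N\<close> outside \<open>V\<close> are
  irrelevant. A Banach space that is a type \<open>'x\<close> of class \<^class>\<open>banach\<close> is the pair
  \<open>(UNIV, norm)\<close>.
\<close>

definition norm_on :: "'v::real_vector set \<Rightarrow> ('v \<Rightarrow> real) \<Rightarrow> bool" where
  "norm_on V N \<longleftrightarrow>
     (\<forall>x\<in>V. 0 \<le> N x \<and> (N x = 0 \<longleftrightarrow> x = 0)) \<and>
     (\<forall>x\<in>V. \<forall>y\<in>V. N (x + y) \<le> N x + N y) \<and>
     (\<forall>c. \<forall>x\<in>V. N (c *\<^sub>R x) = \<bar>c\<bar> * N x)"

definition findim_subspace :: "'v::real_vector set \<Rightarrow> bool" where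
  "findim_subspace V \<longleftrightarrow> (\<exists>B. finite B \<and> V = span B)"

definition linear_map_on :: "'v::real_vector set \<Rightarrow> ('v \<Rightarrow> 'w::real_vector) \<Rightarrow> bool" where
  "linear_map_on V f \<longleftrightarrow>
     (\<forall>x\<in>V. \<forall>y\<in>V. f (x + y) = f x + f y) \<and> (\<forall>c. \<forall>x\<in>V. f (c *\<^sub>R x) = c *\<^sub>R f x)"

text \<open>The operator norm of \<open>f : (V, N) \<rightarrow> 'x\<close>, as in the library's \<^const>\<open>onorm\<close>.\<close>

definition onorm_on :: "'v::real_vector set \<Rightarrow> ('v \<Rightarrow> real) \<Rightarrow> ('v \<Rightarrow> 'x::real_normed_vector) \<Rightarrow> real" where
  "onorm_on V N f = (SUP x\<in>V. norm (f x) / N x)"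

definition one_bounded_on ::
  "'v::real_vector set \<Rightarrow> ('v \<Rightarrow> real) \<Rightarrow> ('w::real_vector \<Rightarrow> real) \<Rightarrow> ('v \<Rightarrow> 'w) \<Rightarrow> bool" where
  "one_bounded_on V N M T \<longleftrightarrow> linear_map_on V T \<and> (\<forall>x\<in>V. M (T x) \<le> N x)"

definition linear_isometry_on ::
  "'v::real_vector set \<Rightarrow> ('v \<Rightarrow> real) \<Rightarrow> ('w::real_vector \<Rightarrow> real) \<Rightarrow> ('v \<Rightarrow> 'w) \<Rightarrow> bool" where
  "linear_isometry_on V N M f \<longleftrightarrow> linear_map_on V f \<and> (\<forall>x\<in>V. M (f x) = N x)"

definition eps_isometry_on ::
  "real \<Rightarrow> 'v::real_vector set \<Rightarrow> ('v \<Rightarrow> real) \<Rightarrow> ('w::real_vector \<Rightarrow> real) \<Rightarrow> ('v \<Rightarrow> 'w) \<Rightarrow> bool" where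
  "eps_isometry_on \<epsilon> V N M f \<longleftrightarrow>
     linear_map_on V f \<and> (\<forall>x\<in>V. (1 - \<epsilon>) * N x \<le> M (f x) \<and> M (f x) \<le> N x)"

definition one_complemented :: "('v::real_vector \<Rightarrow> real) \<Rightarrow> 'v set \<Rightarrow> 'v set \<Rightarrow> bool" where
  "one_complemented N Y V \<longleftrightarrow> subspace Y \<and> Y \<subseteq> V \<and>
     (\<exists>P. one_bounded_on V N N P \<and> P ` V \<subseteq> Y \<and> (\<forall>y\<in>Y. P y = y))"

definition eps_complemented :: "real \<Rightarrow> ('v::real_vector \<Rightarrow> real) \<Rightarrow> 'v set \<Rightarrow> 'v set \<Rightarrow> bool" where
  "eps_complemented \<epsilon> N Y V \<longleftrightarrow> subspace Y \<and> Y \<subseteq> V \<and>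
     (\<exists>T. one_bounded_on V N N T \<and> T ` V \<subseteq> Y \<and> (\<forall>y\<in>Y. N (T y - y) \<le> \<epsilon> * N y))"

section \<open>Monotone FDD and property (E)\<close>

definition monotone_FDD :: "(nat \<Rightarrow> 'x \<Rightarrow> 'x::real_normed_vector) \<Rightarrow> bool" where
  "monotone_FDD P \<longleftrightarrow>
     (\<forall>n. bounded_linear (P n) \<and> findim_subspace (range (P n))) \<and>
     (\<forall>m n. m \<noteq> n \<longrightarrow> (\<forall>x. P m (P n x) = 0)) \<and>
     (\<forall>x. (\<lambda>n. P n x) sums x) \<and>
     (\<forall>n. onorm (\<lambda>x. \<Sum>k<n. P k x) \<le> 1)"

definition has_monotone_FDD :: "'x::real_normed_vector itself \<Rightarrow> bool" where
  "has_monotone_FDD _ \<longleftrightarrow> (\<exists>P :: nat \<Rightarrow> 'x \<Rightarrow> 'x. monotone_FDD P)"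

text \<open>
  The pairs \<open>E \<subseteq> F\<close> are realised inside \<open>nat \<Rightarrow>\<^sub>0 real\<close>, the space of finitely supported sequences,
  of which only the vector space structure is used: the norm \<open>N\<close> is arbitrary and unrelated to
  the library's norm on that type. Since every finite-dimensional space has a linear copy there,
  this is no restriction, as \<open>property_E_arbitrary\<close> below confirms.
\<close>

definition property_E :: "'x::real_normed_vector itself \<Rightarrow> bool" where
  "property_E _ \<longleftrightarrow>
     (\<forall>(F :: (nat \<Rightarrow>\<^sub>0 real) set) N E (i :: (nat \<Rightarrow>\<^sub>0 real) \<Rightarrow> 'x).
        findim_subspace F \<and> norm_on F N \<and> one_complemented N E F \<and>
        linear_isometry_on E N norm i \<and> one_complemented norm (i ` E) UNIV \<longrightarrow>
        (\<forall>\<epsilon>>0. \<exists>g :: (nat \<Rightarrow>\<^sub>0 real) \<Rightarrow> 'x.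
           eps_isometry_on \<epsilon> F N norm g \<and>
           onorm_on E N (\<lambda>x. g x - i x) < \<epsilon> \<and>
           eps_complemented \<epsilon> norm (g ` F) UNIV))"

section \<open>Consistency with library notions\<close>

lemma linear_map_on_UNIV: "linear_map_on UNIV f \<longleftrightarrow> linear f"
  by (auto simp: linear_map_on_def linear_iff)

lemma one_bounded_on_UNIV:
  "one_bounded_on UNIV norm norm T \<longleftrightarrow> bounded_linear T \<and> onorm T \<le> 1"
proof
  assume T: "one_bounded_on UNIV norm norm T"
  then have le: "norm (T x) \<le> 1 * norm x" for x
    by (simp add: one_bounded_on_def)
  have "linear T"
    using T by (simp add: one_bounded_on_def linear_map_on_UNIV)
  then have "bounded_linear T"
    using le by (auto simp: bounded_linear_def bounded_linear_axioms_def intro: exI[of _ 1])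
  then show "bounded_linear T \<and> onorm T \<le> 1"
    using onorm_bound[OF _ le] by simp
next
  assume T: "bounded_linear T \<and> onorm T \<le> 1"
  then have "norm (T x) \<le> norm x" for x
    using onorm[of T x] mult_right_mono[of "onorm T" 1 "norm x"] by simp
  then show "one_bounded_on UNIV norm norm T"
    using T by (simp add: one_bounded_on_def linear_map_on_UNIV bounded_linear.linear)
qed

lemma onorm_on_UNIV: "onorm_on UNIV norm f = onorm f"
  by (simp add: onorm_on_def onorm_def)

lemma findim_embeds:
  fixes F :: "'v::real_vector set"
  assumes "findim_subspace F"
  obtains \<phi> :: "'v \<Rightarrow> nat \<Rightarrow>\<^sub>0 real" and \<psi>
  where "linear \<phi>" "linear \<psi>" "\<And>x. x \<in> F \<Longrightarrow> \<psi> (\<phi> x) = x"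
proof -
  obtain B0 where B0: "finite B0" "F = span B0"
    using assms by (auto simp: findim_subspace_def)
  obtain B where B: "B \<subseteq> B0" "independent B" "B0 \<subseteq> span B"
    using maximal_independent_subset[of B0] by blast
  have F: "F = span B"
    using B B0 by (metis span_mono span_span subset_antisym)
  have "finite B"
    using B(1) B0(1) finite_subset by blast
  then obtain idx :: "'v \<Rightarrow> nat" where idx: "inj_on idx B"
    using finite_imp_inj_to_nat_seg by blast
  define e where "e b = Poly_Mapping.single (idx b) (1::real)" for b
  have lookup_scale: "Poly_Mapping.lookup (c *\<^sub>R p) k = c * Poly_Mapping.lookup p k"
    for c k and p :: "nat \<Rightarrow>\<^sub>0 real"
  proof -
    have "finite {i. c * Poly_Mapping.lookup p i \<noteq> 0}"
      by (rule finite_subset[OF _ finite_keys[of p]]) (auto simp: in_keys_iff)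
    then show ?thesis
      by (simp add: scaleR_poly_mapping_def)
  qed
  obtain \<phi> where \<phi>: "linear \<phi>" "\<And>b. b \<in> B \<Longrightarrow> \<phi> b = e b"
    using linear_independent_extend[OF B(2), of e] by blast
  define \<psi> where "\<psi> p = (\<Sum>b\<in>B. Poly_Mapping.lookup p (idx b) *\<^sub>R b)" for p :: "nat \<Rightarrow>\<^sub>0 real"
  have \<psi>: "linear \<psi>"
    by (rule linearI)
      (simp_all add: \<psi>_def lookup_add lookup_scale scaleR_add_left sum.distrib scaleR_sum_right)
  have "\<psi> (e b) = b" if "b \<in> B" for b
  proof -
    have "\<psi> (e b) = (\<Sum>c\<in>B. if c = b then b else 0)"
      unfolding \<psi>_def e_def
      by (rule sum.cong) (use idx that in \<open>auto simp: lookup_single when_def inj_on_def\<close>)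
    then show ?thesis
      using \<open>finite B\<close> that by simp
  qed
  then have on_B: "(\<psi> \<circ> \<phi>) b = id b" if "b \<in> B" for b
    using \<phi>(2) that by simp
  have "(\<psi> \<circ> \<phi>) x = id x" if "x \<in> span B" for x
    using linear_eq_on[OF linear_compose[OF \<phi>(1) \<psi>] linear_id that on_B] .
  then show ?thesis
    using that[OF \<phi>(1) \<psi>] F by simp
qed

theorem property_E_arbitrary:
  fixes F E :: "'v::real_vector set" and i :: "'v \<Rightarrow> 'x::real_normed_vector"
  assumes X: "property_E TYPE('x)"
    and F: "findim_subspace F" and N: "norm_on F N" and E: "one_complemented N E F"
    and i: "linear_isometry_on E N norm i" and iE: "one_complemented norm (i ` E) UNIV"
    and \<epsilon>: "\<epsilon> > 0"
  shows "\<exists>g :: 'v \<Rightarrow> 'x. eps_isometry_on \<epsilon> F N norm g \<and>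
           onorm_on E N (\<lambda>x. g x - i x) < \<epsilon> \<and> eps_complemented \<epsilon> norm (g ` F) UNIV"
proof -
  obtain \<phi> :: "'v \<Rightarrow> nat \<Rightarrow>\<^sub>0 real" and \<psi>
    where lin: "linear \<phi>" "linear \<psi>" and inv: "\<And>x. x \<in> F \<Longrightarrow> \<psi> (\<phi> x) = x"
    using findim_embeds[OF F] by metis
  obtain P where P: "linear_map_on F P" "\<And>x. x \<in> F \<Longrightarrow> N (P x) \<le> N x" "P ` F \<subseteq> E"
      "\<And>y. y \<in> E \<Longrightarrow> P y = y" and subE: "subspace E" and EF: "E \<subseteq> F"
    using E unfolding one_complemented_def one_bounded_on_def by blast
  have subF: "subspace F"
    using F by (auto simp: findim_subspace_def)
  have plus: "\<phi> (x + y) = \<phi> x + \<phi> y" "\<psi> (p + q) = \<psi> p + \<psi> q" for x y p q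
    using lin by (simp_all add: linear_add)
  have scale: "\<phi> (c *\<^sub>R x) = c *\<^sub>R \<phi> x" "\<psi> (c *\<^sub>R p) = c *\<^sub>R \<psi> p" for c x p
    using lin by (simp_all add: linear_scale)
  have invE: "\<psi> (\<phi> x) = x" if "x \<in> E" for x
    using that EF inv by blast
  have zero: "\<phi> 0 = 0" "\<psi> 0 = 0"
    using lin by (simp_all add: linear_0)
  have clF: "x + y \<in> F" "c *\<^sub>R x \<in> F" if "x \<in> F" "y \<in> F" for x y c
    using subF that by (auto simp: subspace_def)
  have clE: "x + y \<in> E" "c *\<^sub>R x \<in> E" if "x \<in> E" "y \<in> E" for x y c
    using subE that by (auto simp: subspace_def)
  have 1: "findim_subspace (\<phi> ` F)"
    using F lin(1) unfolding findim_subspace_def by (metis finite_imageI linear_span_image)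
  have eq0: "\<phi> x = 0 \<longleftrightarrow> x = 0" if "x \<in> F" for x
    using inv[OF that] zero by metis
  have 2: "norm_on (\<phi> ` F) (N \<circ> \<psi>)"
    using N unfolding norm_on_def by (auto simp: inv plus scale clF eq0)
  have 3: "one_complemented (N \<circ> \<psi>) (\<phi> ` E) (\<phi> ` F)"
    unfolding one_complemented_def one_bounded_on_def
  proof (intro conjI exI)
    show "subspace (\<phi> ` E)"
      using lin(1) subE by (rule linear_subspace_image)
    show "linear_map_on (\<phi> ` F) (\<phi> \<circ> P \<circ> \<psi>)"
      using P(1) by (auto simp: linear_map_on_def plus scale inv)
    have PE: "P x \<in> E" if "x \<in> F" for x
      using P(3) that by blast
    then have PF: "P x \<in> F" if "x \<in> F" for x
      using EF that by blast
    show "\<forall>x\<in>\<phi> ` F. (N \<circ> \<psi>) ((\<phi> \<circ> P \<circ> \<psi>) x) \<le> (N \<circ> \<psi>) x"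
      using PF P(2) by (auto simp: inv)
    show "(\<phi> \<circ> P \<circ> \<psi>) ` \<phi> ` F \<subseteq> \<phi> ` E"
      using PE by (auto simp: inv)
    show "\<forall>y\<in>\<phi> ` E. (\<phi> \<circ> P \<circ> \<psi>) y = y"
      using P(4) by (auto simp: invE)
  qed (use EF in auto)
  have 4: "linear_isometry_on (\<phi> ` E) (N \<circ> \<psi>) norm (i \<circ> \<psi>)"
    using i by (auto simp: linear_isometry_on_def linear_map_on_def plus scale invE)
  have "(i \<circ> \<psi>) ` \<phi> ` E = i ` E"
    by (force simp: image_iff invE)
  then have 5: "one_complemented norm ((i \<circ> \<psi>) ` \<phi> ` E) UNIV"
    using iE by simp
  obtain g where g: "eps_isometry_on \<epsilon> (\<phi> ` F) (N \<circ> \<psi>) norm g"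
      "onorm_on (\<phi> ` E) (N \<circ> \<psi>) (\<lambda>x. g x - (i \<circ> \<psi>) x) < \<epsilon>"
      "eps_complemented \<epsilon> norm (g ` \<phi> ` F) UNIV"
    using X[unfolded property_E_def] 1 2 3 4 5 \<epsilon> by meson
  have "eps_isometry_on \<epsilon> F N norm (g \<circ> \<phi>)"
    using g(1) by (auto simp: eps_isometry_on_def linear_map_on_def plus scale inv)
  moreover have "onorm_on E N (\<lambda>x. (g \<circ> \<phi>) x - i x) < \<epsilon>"
    using g(2) by (simp add: onorm_on_def image_image invE cong: image_cong_simp)
  moreover have "eps_complemented \<epsilon> norm ((g \<circ> \<phi>) ` F) UNIV"
    using g(3) by (simp add: image_comp)
  ultimately show ?thesis
    by blast
qed

end

theory Submission
  imports Defs
begin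

text \<open>
  If \<open>e : V \<rightarrow> W\<close> and \<open>r : W \<rightarrow> V\<close> are contractions of finite-dimensional spaces with
  \<open>\<parallel>r e - id\<parallel> \<le> \<delta>\<close>, then \<open>V \<times> W\<close> has a norm for which both factors are isometric and 1-complemented
  and \<open>x\<close> is \<open>\<delta> \<parallel>x\<parallel>\<close>-close to \<open>e x\<close>. Property (E), which only speaks of exact embeddings, thus also
  extends along such approximately split maps. A contraction from the range of an FDD projection of
  one space into the other, with an approximate left inverse, is compressed by a late FDD projection
  of the target and then extended to an almost split contraction in the opposite direction that
  nearly inverts it. Iterating with summable errors gives contractions in both directions that
  converge pointwise to mutually inverse contractions, that is, to a bijective isometry.
\<close>

section \<open>Linear maps on finite-dimensional subspaces\<close>

lemma linear_map_on_linear: "linear f \<Longrightarrow> linear_map_on V f"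
  by (simp add: linear_map_on_def linear_add linear_scale)

lemma linear_map_on_0: "linear_map_on V f \<Longrightarrow> subspace V \<Longrightarrow> f 0 = 0"
  unfolding linear_map_on_def using subspace_0[of V] by (metis scaleR_zero_left)

lemma linear_map_on_diff:
  assumes "linear_map_on V f" "subspace V" "x \<in> V" "y \<in> V"
  shows "f (x - y) = f x - f y"
proof -
  have "f (x + (-1) *\<^sub>R y) = f x + (-1) *\<^sub>R f y"
    using assms subspace_scale[of V y "-1"] unfolding linear_map_on_def by metis
  then show ?thesis
    by simp
qed

lemma linear_map_on_sum:
  assumes f: "linear_map_on V f" "subspace V" and "finite B" "B \<subseteq> V"
  shows "f (\<Sum>b\<in>B. c b *\<^sub>R b) = (\<Sum>b\<in>B. c b *\<^sub>R f b)"
  using assms(3,4)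
proof (induction B)
  case empty
  then show ?case
    using linear_map_on_0[OF f] by simp
next
  case (insert a B)
  have "(\<Sum>b\<in>B. c b *\<^sub>R b) \<in> V" "c a *\<^sub>R a \<in> V"
    using insert.prems f(2) by (auto intro!: subspace_sum subspace_scale)
  then have "f (c a *\<^sub>R a + (\<Sum>b\<in>B. c b *\<^sub>R b)) = c a *\<^sub>R f a + f (\<Sum>b\<in>B. c b *\<^sub>R b)"
    using f(1) insert.prems unfolding linear_map_on_def by auto
  then show ?case
    using insert by simp
qed

text \<open>On the compact set of coefficient families whose largest entry has modulus 1, the norm
  of the combination attains a minimum, which is positive by independence. Dividing by the largest
  coefficient reduces the general case to this set.\<close>

lemma coordinates_bounded:
  fixes B :: "'v::real_normed_vector set"
  assumes fin: "finite B" and ind: "independent B"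
  obtains C where "C > 0" "\<And>c b. b \<in> B \<Longrightarrow> \<bar>c b\<bar> \<le> C * norm (\<Sum>a\<in>B. c a *\<^sub>R a)"
proof (cases "B = {}")
  case True
  then show ?thesis
    using that[of 1] by simp
next
  case False
  \<comment> \<open>Families are indexed by the whole type, so Tychonoff gives compactness of the
    cube. Only entries in \<open>B\<close> matter for the sum, hence the entry of modulus 1 is
    demanded there.\<close>
  define S :: "('v \<Rightarrow> real) set" where
    "S = (\<Pi>\<^sub>E b\<in>UNIV. {-1..1}) \<inter> (\<Union>b\<in>B. {c. \<bar>c b\<bar> = 1})"
  have "compactin (product_topology (\<lambda>i::'v. euclidean) UNIV) (\<Pi>\<^sub>E b\<in>UNIV. {-1..1::real})"
    by (simp add: compactin_PiE)
  then have "compact (\<Pi>\<^sub>E b\<in>(UNIV::'v set). {-1..1::real})"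
    by (simp add: euclidean_product_topology)
  moreover have "closed (\<Union>b\<in>B. {c :: 'v \<Rightarrow> real. \<bar>c b\<bar> = 1})"
    by (intro closed_UN fin ballI closed_Collect_eq continuous_intros) auto
  ultimately have "compact S"
    unfolding S_def by (rule compact_Int_closed)
  moreover have "(\<lambda>_. 1) \<in> S"
    using False by (auto simp: S_def)
  moreover have "continuous_on S (\<lambda>c. norm (\<Sum>a\<in>B. c a *\<^sub>R a))"
    by (intro continuous_intros continuous_on_subset[OF continuous_on_product_coordinates]) auto
  ultimately obtain c0 where c0: "c0 \<in> S"
      "\<And>c. c \<in> S \<Longrightarrow> norm (\<Sum>a\<in>B. c0 a *\<^sub>R a) \<le> norm (\<Sum>a\<in>B. c a *\<^sub>R a)"
    using continuous_attains_inf[of S "\<lambda>c. norm (\<Sum>a\<in>B. c a *\<^sub>R a)"] by blast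
  define \<mu> where "\<mu> = norm (\<Sum>a\<in>B. c0 a *\<^sub>R a)"
  have "(\<Sum>a\<in>B. c0 a *\<^sub>R a) \<noteq> 0"
    using c0(1) ind fin independentD[of B B c0] by (fastforce simp: S_def)
  then have \<mu>: "\<mu> > 0"
    by (simp add: \<mu>_def)
  show ?thesis
  proof (rule that[of "1 / \<mu>"])
    fix c :: "'v \<Rightarrow> real" and b assume b: "b \<in> B"
    obtain m where m: "m \<in> B" "\<And>a. a \<in> B \<Longrightarrow> \<bar>c a\<bar> \<le> \<bar>c m\<bar>"
    proof -
      have "Max ((\<lambda>a. \<bar>c a\<bar>) ` B) \<in> (\<lambda>a. \<bar>c a\<bar>) ` B"
        using fin False by (intro Max_in) auto
      then obtain m where "m \<in> B" "Max ((\<lambda>a. \<bar>c a\<bar>) ` B) = \<bar>c m\<bar>"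
        by blast
      then show thesis
        using that[of m] fin by (metis Max_ge finite_imageI imageI)
    qed
    show "\<bar>c b\<bar> \<le> 1 / \<mu> * norm (\<Sum>a\<in>B. c a *\<^sub>R a)"
    proof (cases "c m = 0")
      case True
      then show ?thesis
        using m(2)[OF b] \<mu> by simp
    next
      case False
      \<comment> \<open>Setting \<open>d\<close> to 0 off \<open>B\<close> keeps it in the cube,
        since \<open>c\<close> is not controlled there.\<close>
      define d where "d a = (if a \<in> B then c a / c m else 0)" for a
      have "\<bar>d a\<bar> \<le> 1" for a
        using m(2)[of a] False by (simp add: d_def)
      then have "d a \<in> {-1..1}" for a
        unfolding atLeastAtMost_iff by (metis abs_le_iff minus_le_iff)
      moreover have "\<bar>d m\<bar> = 1"
        using m(1) False by (simp add: d_def)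
      ultimately have "d \<in> S"
        using m(1) by (auto simp: S_def PiE_def)
      then have "\<mu> \<le> norm (\<Sum>a\<in>B. d a *\<^sub>R a)"
        using c0(2) by (simp add: \<mu>_def)
      also have "(\<Sum>a\<in>B. d a *\<^sub>R a) = (1 / c m) *\<^sub>R (\<Sum>a\<in>B. c a *\<^sub>R a)"
        by (simp add: d_def scaleR_sum_right)
      also have "norm \<dots> = norm (\<Sum>a\<in>B. c a *\<^sub>R a) / \<bar>c m\<bar>"
        by simp
      finally have "\<bar>c m\<bar> \<le> norm (\<Sum>a\<in>B. c a *\<^sub>R a) / \<mu>"
        using False \<mu> by (simp add: field_simps)
      then show ?thesis
        using m(2)[OF b] by simp
    qed
  qed (use \<mu> in simp)
qed

text \<open>Coordinates of \<open>x\<close> are bounded by a multiple of \<open>norm x\<close>, so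
  convergence at the finitely many basis vectors controls the maps on all of
  \<open>V\<close>.\<close>

lemma findim_tendsto_0_uniformly:
  fixes V :: "'v::real_normed_vector set" and f :: "nat \<Rightarrow> 'v \<Rightarrow> 'w::real_normed_vector"
  assumes V: "findim_subspace V" and f: "\<And>n. linear_map_on V (f n)"
    and lim: "\<And>x. x \<in> V \<Longrightarrow> (\<lambda>n. f n x) \<longlonglongrightarrow> 0" and \<eta>: "\<eta> > 0"
  shows "\<forall>\<^sub>F n in sequentially. \<forall>x\<in>V. norm (f n x) \<le> \<eta> * norm x"
proof -
  obtain B0 where B0: "finite B0" "V = span B0"
    using V by (auto simp: findim_subspace_def)
  obtain B where B: "B \<subseteq> B0" "independent B" "B0 \<subseteq> span B"
    using maximal_independent_subset[of B0] by blast
  have VB: "V = span B"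
    using B B0 by (metis span_mono span_span subset_antisym)
  have fin: "finite B"
    using B(1) B0(1) finite_subset by blast
  obtain C where C: "C > 0" "\<And>c b. b \<in> B \<Longrightarrow> \<bar>c b\<bar> \<le> C * norm (\<Sum>a\<in>B. c a *\<^sub>R a)"
    using coordinates_bounded[OF fin B(2)] by metis
  have sub: "subspace V" "B \<subseteq> V"
    by (auto simp: VB span_base)
  have "(\<lambda>n. C * (\<Sum>b\<in>B. norm (f n b))) \<longlonglongrightarrow> C * (\<Sum>b\<in>B. norm (0::'w))"
    using sub(2) by (intro tendsto_intros lim) auto
  then have "(\<lambda>n. C * (\<Sum>b\<in>B. norm (f n b))) \<longlonglongrightarrow> 0"
    by simp
  then have "\<forall>\<^sub>F n in sequentially. C * (\<Sum>b\<in>B. norm (f n b)) < \<eta>"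
    using order_tendstoD(2)[OF _ \<eta>] by blast
  then show ?thesis
  proof (rule eventually_mono, intro ballI)
    fix n x assume n: "C * (\<Sum>b\<in>B. norm (f n b)) < \<eta>" and "x \<in> V"
    then obtain c where x: "x = (\<Sum>b\<in>B. c b *\<^sub>R b)"
      by (auto simp: VB span_finite[OF fin])
    have "norm (f n x) \<le> (\<Sum>b\<in>B. \<bar>c b\<bar> * norm (f n b))"
      unfolding x linear_map_on_sum[OF f sub(1) fin sub(2)]
      by (rule order_trans[OF norm_sum]) simp
    also have "\<dots> \<le> (\<Sum>b\<in>B. (C * norm x) * norm (f n b))"
      by (intro sum_mono mult_right_mono) (auto simp: x intro: C(2))
    also have "\<dots> = (C * (\<Sum>b\<in>B. norm (f n b))) * norm x"
      by (simp add: sum_distrib_left mult_ac)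
    also have "\<dots> \<le> \<eta> * norm x"
      using n by (intro mult_right_mono) auto
    finally show "norm (f n x) \<le> \<eta> * norm x" .
  qed
qed

section \<open>Amalgamation along an almost split embedding\<close>

lemma norm_on_subset:
  assumes "norm_on V N" "W \<subseteq> V"
  shows "norm_on W N"
proof -
  have "x \<in> V" if "x \<in> W" for x
    using assms(2) that by blast
  then show ?thesis
    using assms(1) by (simp add: norm_on_def)
qed

text \<open>The bound \<open>K\<close> makes the supremum in \<open>onorm_on\<close> finite, so that
  it really dominates each quotient. Quotients with \<open>N x = 0\<close> are 0 by the convention
  on division.\<close>

lemma onorm_on_bound:
  assumes N: "norm_on V N" and f: "\<And>x. x \<in> V \<Longrightarrow> norm (f x) \<le> K * N x"
    and K: "K \<ge> 0" and V: "0 \<in> V"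
  shows "onorm_on V N f \<le> K"
    and "\<And>x. x \<in> V \<Longrightarrow> norm (f x) \<le> onorm_on V N f * N x"
proof -
  have le: "norm (f x) / N x \<le> K" if "x \<in> V" for x
    using N f[OF that] that K unfolding norm_on_def
    by (cases "N x = 0") (auto simp: divide_le_eq less_le)
  show "onorm_on V N f \<le> K"
    unfolding onorm_on_def using V le by (intro cSUP_least) auto
  fix x assume x: "x \<in> V"
  have "norm (f x) / N x \<le> onorm_on V N f"
    unfolding onorm_on_def using le x by (intro cSUP_upper bdd_aboveI2) auto
  then show "norm (f x) \<le> onorm_on V N f * N x"
    using N f[OF x] x unfolding norm_on_def
    by (cases "N x = 0") (auto simp: divide_le_eq less_le)
qed

lemma findim_subspace_Times:
  assumes "findim_subspace V" "findim_subspace W"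
  shows "findim_subspace (V \<times> W)"
proof -
  obtain B C where BC: "finite B" "V = span B" "finite C" "W = span C"
    using assms by (auto simp: findim_subspace_def)
  let ?D = "(\<lambda>b. (b, 0)) ` B \<union> (\<lambda>c. (0, c)) ` C"
  have lin: "linear (\<lambda>b::'a. (b, 0::'b))" "linear (\<lambda>c::'b. (0::'a, c))"
    by (auto intro!: linearI)
  have "span ?D = V \<times> W"
    unfolding span_Un linear_span_image[OF lin(1)] linear_span_image[OF lin(2)] BC
    by force
  then show ?thesis
    unfolding findim_subspace_def using BC by (intro exI[of _ ?D]) auto
qed

text \<open>
  The norm \<open>max (\<parallel>x + r y\<parallel>) (\<parallel>e x + y\<parallel>) (\<delta> \<parallel>x\<parallel>)\<close> on \<open>V \<times> W\<close> makes both factors isometric copies that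
  are 1-complemented via \<open>(x, y) \<mapsto> x + r y\<close> and \<open>(x, y) \<mapsto> e x + y\<close>, while \<open>(x, 0)\<close> and
  \<open>(0, e x)\<close> are only \<open>\<delta> \<parallel>x\<parallel>\<close> apart. Property (E) is applied to \<open>V \<times> {0} \<subseteq> V \<times> W\<close>.
\<close>

lemma property_E_amalgam:
  fixes V :: "'v::real_normed_vector set" and W :: "'w::real_normed_vector set"
    and i :: "'v \<Rightarrow> 'x::real_normed_vector"
  assumes E: "property_E TYPE('x)"
    and V: "findim_subspace V" and W: "findim_subspace W"
    and i: "linear_isometry_on V norm norm i" "one_complemented norm (i ` V) UNIV"
    and e: "one_bounded_on V norm norm e" "e ` V \<subseteq> W"
    and r: "one_bounded_on W norm norm r" "r ` W \<subseteq> V"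
    and re: "\<And>x. x \<in> V \<Longrightarrow> norm (r (e x) - x) \<le> \<delta> * norm x"
    and \<delta>: "0 < \<delta>" "\<delta> \<le> 1" and \<epsilon>: "0 < \<epsilon>" "\<epsilon> \<le> 1"
  obtains f s where
    "one_bounded_on W norm norm f" "one_bounded_on UNIV norm norm s" "range s \<subseteq> W"
    "\<And>y. y \<in> W \<Longrightarrow> norm (s (f y) - y) \<le> \<epsilon> * norm y"
    "\<And>x. x \<in> V \<Longrightarrow> norm (f (e x) - i x) \<le> (\<delta> + \<epsilon>) * norm x"
proof -
  have sub: "subspace V" "subspace W"
    using V W by (auto simp: findim_subspace_def)
  have V0: "0 \<in> V" "0 \<in> W"
    using sub by (auto simp: subspace_0)
  have clV: "x + y \<in> V" "c *\<^sub>R x \<in> V" if "x \<in> V" "y \<in> V" for x y c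
    using sub that by (auto simp: subspace_def)
  have clW: "x + y \<in> W" "c *\<^sub>R x \<in> W" if "x \<in> W" "y \<in> W" for x y c
    using sub that by (auto simp: subspace_def)
  have rl: "r (x + y) = r x + r y" "r (c *\<^sub>R x) = c *\<^sub>R r x" "norm (r x) \<le> norm x" "r x \<in> V"
    if "x \<in> W" "y \<in> W" for x y c
    using r that by (auto simp: one_bounded_on_def linear_map_on_def)
  have el: "e (x + y) = e x + e y" "e (c *\<^sub>R x) = c *\<^sub>R e x" "norm (e x) \<le> norm x" "e x \<in> W"
    if "x \<in> V" "y \<in> V" for x y c
    using e that by (auto simp: one_bounded_on_def linear_map_on_def)
  have il: "i (x + y) = i x + i y" "i (c *\<^sub>R x) = c *\<^sub>R i x" "norm (i x) = norm x"
    if "x \<in> V" "y \<in> V" for x y c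
    using i(1) that by (auto simp: linear_isometry_on_def linear_map_on_def)
  have zero: "r 0 = 0" "e 0 = 0"
    using r(1) e(1) sub by (auto simp: one_bounded_on_def intro: linear_map_on_0)
  define N where "N p = max (norm (fst p + r (snd p))) (max (norm (e (fst p) + snd p)) (\<delta> * norm (fst p)))"
    for p :: "'v \<times> 'w"
  define F where "F = V \<times> W"
  have subF: "subspace F"
    using sub by (simp add: F_def subspace_Times)
  have F: "findim_subspace F"
    unfolding F_def using V W by (rule findim_subspace_Times)
  have Nl: "norm (fst p + r (snd p)) \<le> N p" "norm (e (fst p) + snd p) \<le> N p" "\<delta> * norm (fst p) \<le> N p" for p
    by (simp_all add: N_def)
  \<comment> \<open>Contractivity of \<open>e\<close> and \<open>\<delta> \<le> 1\<close> leave the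
    first entry as the maximum.\<close>
  have NV: "N (x, 0) = norm x" if "x \<in> V" for x
    using el(3)[OF that that] mult_right_mono[OF \<delta>(2), of "norm x"]
    by (auto simp: N_def zero max_def)
  have NW: "N (0, y) = norm y" if "y \<in> W" for y
    using rl(3)[OF that that] by (auto simp: N_def zero max_def)
  have N: "norm_on F N"
    unfolding norm_on_def
  proof (intro conjI ballI allI)
    fix p assume p: "p \<in> F"
    show "0 \<le> N p"
      by (simp add: N_def le_max_iff_disj)
    show "N p = 0 \<longleftrightarrow> p = 0"
    proof
      assume 0: "N p = 0"
      \<comment> \<open>The entry with \<open>\<delta> > 0\<close> makes \<open>N\<close> definite:
        the other two both vanish at \<open>(x, - e x)\<close> whenever
        \<open>r (e x) = x\<close>.\<close>
      then have "fst p = 0"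
        using Nl(3)[of p] \<delta> by (simp add: mult_le_0_iff)
      moreover from this have "snd p = 0"
        using Nl(2)[of p] 0 by (simp add: zero)
      ultimately show "p = 0"
        by (simp add: prod_eq_iff)
    qed (simp add: N_def zero)
  next
    fix p q assume "p \<in> F" "q \<in> F"
    then have pq: "fst p \<in> V" "snd p \<in> W" "fst q \<in> V" "snd q \<in> W"
      by (auto simp: F_def)
    have "norm (fst (p + q) + r (snd (p + q))) \<le> norm (fst p + r (snd p)) + norm (fst q + r (snd q))"
      using pq norm_triangle_ineq[of "fst p + r (snd p)" "fst q + r (snd q)"]
      by (simp add: rl add_ac)
    moreover have "norm (e (fst (p + q)) + snd (p + q)) \<le> norm (e (fst p) + snd p) + norm (e (fst q) + snd q)"
      using pq norm_triangle_ineq[of "e (fst p) + snd p" "e (fst q) + snd q"]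
      by (simp add: el add_ac)
    moreover have "\<delta> * norm (fst (p + q)) \<le> \<delta> * norm (fst p) + \<delta> * norm (fst q)"
      using mult_left_mono[OF norm_triangle_ineq[of "fst p" "fst q"], of \<delta>] \<delta>(1)
      by (simp add: distrib_left)
    ultimately show "N (p + q) \<le> N p + N q"
      using Nl[of p] Nl[of q] unfolding N_def[of "p + q"] by simp
  next
    fix c p assume "p \<in> F"
    then have p: "fst p \<in> V" "snd p \<in> W"
      by (auto simp: F_def)
    have "fst (c *\<^sub>R p) + r (snd (c *\<^sub>R p)) = c *\<^sub>R (fst p + r (snd p))"
      "e (fst (c *\<^sub>R p)) + snd (c *\<^sub>R p) = c *\<^sub>R (e (fst p) + snd p)"
      using p by (simp_all add: rl el scaleR_add_right)
    then show "N (c *\<^sub>R p) = \<bar>c\<bar> * N p"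
      unfolding N_def by (simp add: max_mult_distrib_left mult_ac)
  qed
  define E0 where "E0 = V \<times> {0::'w}"
  have E0F: "E0 \<subseteq> F"
    using V0 by (auto simp: E0_def F_def)
  have subE: "subspace E0"
    using sub by (simp add: E0_def subspace_Times)
  have E0: "one_complemented N E0 F"
    unfolding one_complemented_def one_bounded_on_def
  proof (intro conjI exI[of _ "\<lambda>p. (fst p + r (snd p), 0)"])
    show "linear_map_on F (\<lambda>p. (fst p + r (snd p), 0))"
      by (auto simp: linear_map_on_def F_def rl scaleR_add_right)
    show "\<forall>p\<in>F. N (fst p + r (snd p), 0) \<le> N p"
      using Nl(1) by (auto simp: F_def NV clV rl)
  qed (use subE E0F in \<open>auto simp: E0_def F_def clV rl zero\<close>)
  have iso: "linear_isometry_on E0 N norm (i \<circ> fst)"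
    by (auto simp: linear_isometry_on_def linear_map_on_def E0_def il NV)
  have "(i \<circ> fst) ` E0 = i ` V"
    by (force simp: E0_def)
  then have "one_complemented norm ((i \<circ> fst) ` E0) UNIV"
    using i(2) by simp
  \<comment> \<open>Half of \<open>\<epsilon>\<close> pays for the approximate projection, the other
    half for the rescaling that makes \<open>s\<close> a contraction.\<close>
  from property_E_arbitrary[OF E F N E0 iso this, of "\<epsilon> / 2"]
  obtain g where g: "eps_isometry_on (\<epsilon> / 2) F N norm g"
      "onorm_on E0 N (\<lambda>p. g p - (i \<circ> fst) p) < \<epsilon> / 2" "eps_complemented (\<epsilon> / 2) norm (g ` F) UNIV"
    using \<epsilon> by auto
  have gl: "linear_map_on F g" and gN: "\<And>p. p \<in> F \<Longrightarrow> norm (g p) \<le> N p"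
      and gN': "\<And>p. p \<in> F \<Longrightarrow> (1 - \<epsilon> / 2) * N p \<le> norm (g p)"
    using g(1) by (auto simp: eps_isometry_on_def)
  obtain T where Tl: "linear T" and T: "\<And>z. norm (T z) \<le> norm z" "\<And>z. T z \<in> g ` F"
      "\<And>p. p \<in> F \<Longrightarrow> norm (T (g p) - g p) \<le> \<epsilon> / 2 * norm (g p)"
    using g(3) unfolding eps_complemented_def one_bounded_on_def linear_map_on_UNIV by blast
  \<comment> \<open>\<open>u\<close> will be the inverse of \<open>g\<close> applied after
    \<open>T\<close>. The lower bound for \<open>g\<close> makes preimages unique, and uniqueness
    makes \<open>u\<close> linear.\<close>
  have "\<exists>p\<in>F. g p = T z" for z
    using T(2)[of z] by (metis imageE)
  then obtain u where u: "\<And>z. u z \<in> F" "\<And>z. g (u z) = T z"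
    by metis
  have uniq: "p = q" if "p \<in> F" "q \<in> F" "g p = g q" for p q
  proof -
    have pq: "p - q \<in> F"
      using that subF by (simp add: subspace_diff)
    have "g (p - q) = 0"
      using linear_map_on_diff[OF gl subF] that by simp
    then have "(1 - \<epsilon> / 2) * N (p - q) \<le> 0"
      using gN'[OF pq] by simp
    then have "N (p - q) = 0"
      using \<epsilon> N pq by (auto simp: norm_on_def mult_le_0_iff intro: antisym)
    then show "p = q"
      using N pq by (simp add: norm_on_def)
  qed
  have u_add: "u (y + z) = u y + u z" for y z
    using gl subF u Tl by (intro uniq) (auto simp: linear_map_on_def linear_add subspace_add)
  have u_scale: "u (c *\<^sub>R z) = c *\<^sub>R u z" for c z
    using gl subF u Tl by (intro uniq) (auto simp: linear_map_on_def linear_scale subspace_scale)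
  \<comment> \<open>Up to the identification of \<open>W\<close> with the second factor, this is the
    norm-one projection onto \<open>W\<close>.\<close>
  define q where "q p = e (fst p) + snd p" for p
  have q_W: "q p \<in> W" if "p \<in> F" for p
    using that el clW by (auto simp: q_def F_def)
  have q_add: "q (p + p') = q p + q p'" and q_scale: "q (c *\<^sub>R p) = c *\<^sub>R q p"
    if "p \<in> F" "p' \<in> F" for p p' c
    using that by (auto simp: q_def F_def el scaleR_add_right)
  have qN: "norm (q p) \<le> N p" for p
    using Nl(2) by (simp add: q_def)
  define f where "f y = g (0, y)" for y
  \<comment> \<open>The inverse of \<open>g\<close> may have norm up to the reciprocal of
    \<open>1 - \<epsilon> / 2\<close>; the factor compensates exactly.\<close>
  define s where "s z = (1 - \<epsilon> / 2) *\<^sub>R q (u z)" for z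
  show ?thesis
  proof (rule that[of f s])
    show "one_bounded_on W norm norm f"
      unfolding one_bounded_on_def
    proof
      have "f (x + y) = f x + f y \<and> f (c *\<^sub>R x) = c *\<^sub>R f x" if "x \<in> W" "y \<in> W" for x y c
      proof -
        have "(0, x) \<in> F" "(0, y) \<in> F"
          using that V0 by (auto simp: F_def)
        then have "g ((0, x) + (0, y)) = g (0, x) + g (0, y)" "g (c *\<^sub>R (0, x)) = c *\<^sub>R g (0, x)"
          using gl unfolding linear_map_on_def by blast+
        then show ?thesis
          by (simp add: f_def)
      qed
      then show "linear_map_on W f"
        unfolding linear_map_on_def by blast
      show "\<forall>y\<in>W. norm (f y) \<le> norm y"
        using gN NW V0 by (force simp: f_def F_def)
    qed
    show "one_bounded_on UNIV norm norm s"
      unfolding one_bounded_on_def linear_map_on_UNIV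
    proof (intro conjI ballI)
      show "linear s"
        by (rule linearI) (simp_all add: s_def u_add u_scale q_add q_scale[OF u(1) u(1)] u scaleR_add_right)
      fix z
      have "norm (s z) \<le> (1 - \<epsilon> / 2) * N (u z)"
        using qN[of "u z"] \<epsilon> by (simp add: s_def mult_left_mono)
      also have "\<dots> \<le> norm (T z)"
        using gN'[OF u(1)] by (simp add: u)
      finally show "norm (s z) \<le> norm z"
        using T(1) order_trans by blast
    qed
    show "range s \<subseteq> W"
      using q_W[OF u(1)] sub(2) by (auto simp: s_def subspace_scale)
    show "norm (s (f y) - y) \<le> \<epsilon> * norm y" if y: "y \<in> W" for y
    proof -
      have yF: "(0, y) \<in> F"
        using y V0 by (simp add: F_def)
      \<comment> \<open>The failure of \<open>T\<close> to fix \<open>g (0, y)\<close>, pulled back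
        along \<open>g\<close>. Since \<open>q (0, y) = y\<close>, the error of \<open>s\<close>
        consists of the rescaled \<open>q ?d\<close> and of \<open>\<epsilon> / 2\<close> times
        \<open>y\<close>.\<close>
      let ?d = "u (f y) - (0, y)"
      have dF: "?d \<in> F"
        using u(1) yF subF by (simp add: subspace_diff)
      have "g ?d = T (g (0, y)) - g (0, y)"
        using linear_map_on_diff[OF gl subF u(1) yF] by (simp add: u f_def)
      then have "norm (g ?d) \<le> \<epsilon> / 2 * norm (g (0, y))"
        using T(3)[OF yF] by simp
      also have "\<dots> \<le> \<epsilon> / 2 * norm y"
        using gN[OF yF] NW[OF y] \<epsilon> by (intro mult_left_mono) auto
      finally have d: "(1 - \<epsilon> / 2) * N ?d \<le> \<epsilon> / 2 * norm y"
        using gN'[OF dF] by simp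
      have "q ((0, y) + ?d) = q (0, y) + q ?d"
        using q_add[OF yF dF] .
      then have "s (f y) - y = (1 - \<epsilon> / 2) *\<^sub>R q ?d - (\<epsilon> / 2) *\<^sub>R y"
        by (simp add: s_def q_def[of "(0, y)"] zero algebra_simps)
      then have "norm (s (f y) - y) \<le> (1 - \<epsilon> / 2) * norm (q ?d) + \<epsilon> / 2 * norm y"
        using norm_triangle_ineq4[of "(1 - \<epsilon> / 2) *\<^sub>R q ?d" "(\<epsilon> / 2) *\<^sub>R y"] \<epsilon> by simp
      also have "(1 - \<epsilon> / 2) * norm (q ?d) \<le> (1 - \<epsilon> / 2) * N ?d"
        using qN[of ?d] \<epsilon> by (intro mult_left_mono) auto
      finally show ?thesis
        using d by simp
    qed
    show "norm (f (e x) - i x) \<le> (\<delta> + \<epsilon>) * norm x" if x: "x \<in> V" for x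
    proof -
      have xF: "(x, 0) \<in> F" "(0, e x) \<in> F"
        using x V0 el by (auto simp: F_def)
      have xE: "(x, 0) \<in> E0"
        using x by (simp add: E0_def)
      have "g ((0, e x) - (x, 0)) = g (0, e x) - g (x, 0)"
        using linear_map_on_diff[OF gl subF] xF by blast
      moreover have "norm (g ((0, e x) - (x, 0))) \<le> N ((0, e x) - (x, 0))"
        using gN subspace_diff[OF subF] xF by blast
      moreover have "e (- x) = - e x"
        using el(2)[OF x x, of "-1"] by simp
      \<comment> \<open>At \<open>(- x, e x)\<close> the middle entry vanishes and the first is the
        defect of \<open>r\<close> as a left inverse of \<open>e\<close>, so the two copies of
        \<open>x\<close> are \<open>\<delta> * norm x\<close> apart.\<close>
      then have "N ((0, e x) - (x, 0)) = max (norm (r (e x) - x)) (max 0 (\<delta> * norm x))"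
        by (simp add: N_def)
      then have "N ((0, e x) - (x, 0)) \<le> \<delta> * norm x"
        using re[OF x] \<delta>(1) by simp
      ultimately have 1: "norm (g (0, e x) - g (x, 0)) \<le> \<delta> * norm x"
        by simp
      have NE: "norm_on E0 N"
        using norm_on_subset[OF N E0F] .
      \<comment> \<open>This crude bound only ensures that the supremum defining the operator norm
        is finite.\<close>
      have le: "norm (g p - (i \<circ> fst) p) \<le> 2 * N p" if "p \<in> E0" for p
      proof -
        have "norm ((i \<circ> fst) p) = N p"
          using iso that by (auto simp: linear_isometry_on_def)
        then show ?thesis
          using gN[of p] that E0F norm_triangle_ineq4[of "g p" "(i \<circ> fst) p"] by auto
      qed
      have "norm (g (x, 0) - (i \<circ> fst) (x, 0)) \<le> onorm_on E0 N (\<lambda>p. g p - (i \<circ> fst) p) * N (x, 0)"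
        using onorm_on_bound(2)[OF NE le _ subspace_0[OF subE] xE] by simp
      also have "\<dots> \<le> \<epsilon> * norm x"
        using g(2) \<epsilon> by (auto simp: NV x intro!: mult_right_mono)
      finally have 2: "norm (g (x, 0) - i x) \<le> \<epsilon> * norm x"
        by simp
      show ?thesis
        using 1 2 norm_triangle_ineq[of "g (0, e x) - g (x, 0)" "g (x, 0) - i x"]
        by (simp add: f_def algebra_simps)
    qed
  qed
qed

section \<open>Finite-rank projections from a monotone FDD\<close>

text \<open>The partial-sum projections of a monotone FDD; the case \<open>m = n\<close> of the
  composition rule is idempotence.\<close>

definition fd_projections :: "(nat \<Rightarrow> 'x \<Rightarrow> 'x::real_normed_vector) \<Rightarrow> bool" where
  "fd_projections Q \<longleftrightarrow>
     (\<forall>n. linear (Q n) \<and> findim_subspace (range (Q n)) \<and> (\<forall>x. norm (Q n x) \<le> norm x)) \<and>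
     (\<forall>m n x. Q m (Q n x) = Q (min m n) x) \<and>
     (\<forall>x. (\<lambda>n. Q n x) \<longlonglongrightarrow> x)"

lemma findim_subspace_mono:
  assumes "subspace V" "V \<subseteq> span B" "finite B"
  shows "findim_subspace V"
proof -
  obtain C where C: "C \<subseteq> V" "independent C" "V \<subseteq> span C"
    using maximal_independent_subset[of V] by blast
  then have "finite C"
    using independent_span_bound[OF assms(3) C(2)] assms(2) by auto
  moreover have "V = span C"
    using C assms(1) by (simp add: span_minimal subset_antisym)
  ultimately show ?thesis
    unfolding findim_subspace_def by blast
qed

lemma monotone_FDD_projections:
  fixes P :: "nat \<Rightarrow> 'x \<Rightarrow> 'x::real_normed_vector"
  assumes "monotone_FDD P"
  shows "fd_projections (\<lambda>n x. \<Sum>k<n. P k x)"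
proof -
  have bl: "bounded_linear (P n)" and fin: "findim_subspace (range (P n))"
    and orth: "m \<noteq> n \<Longrightarrow> P m (P n x) = 0" and sums: "(\<lambda>n. P n x) sums x"
    and le1: "onorm (\<lambda>x. \<Sum>k<n. P k x) \<le> 1" for m n x
    using assms unfolding monotone_FDD_def by blast+
  have blQ: "bounded_linear (\<lambda>x. \<Sum>k<n. P k x)" for n
    by (intro bounded_linear_sum bl)
  \<comment> \<open>Orthogonality concerns distinct indices only. Expanding the vector
    \<open>P n x\<close> itself leaves just the term with index \<open>n\<close>, which gives
    idempotence.\<close>
  have "P n (P n x) = P n x" for n x
  proof -
    have "(\<lambda>m. P m (P n x)) sums P n (P n x)"
      using sums_finite[of "{n}" "\<lambda>m. P m (P n x)"] orth by auto
    then show ?thesis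
      using sums sums_unique2 by blast
  qed
  then have PP: "P m (P n x) = (if m = n then P m x else 0)" for m n x
    using orth by auto
  have "(\<Sum>j<m. P j (\<Sum>k<n. P k x)) = (\<Sum>k<min m n. P k x)" for m n x
  proof -
    have "(\<Sum>j<m. P j (\<Sum>k<n. P k x)) = (\<Sum>j<m. \<Sum>k<n. P j (P k x))"
      by (simp add: linear_sum[OF bounded_linear.linear[OF bl]])
    also have "\<dots> = (\<Sum>j<m. if j < n then P j x else 0)"
      by (simp add: PP)
    also have "\<dots> = (\<Sum>j\<in>{..<m} \<inter> {j. j < n}. P j x)"
      by (simp add: sum.inter_restrict)
    also have "{..<m} \<inter> {j. j < n} = {..<min m n}"
      by auto
    finally show ?thesis .
  qed
  moreover have "norm (\<Sum>k<n. P k x) \<le> norm x" for n x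
    using onorm[OF blQ[of n], of x] mult_right_mono[OF le1[of n], of "norm x"] by simp
  moreover have "findim_subspace (range (\<lambda>x. \<Sum>k<n. P k x))" for n
  proof -
    obtain B where B: "finite (B k)" "range (P k) = span (B k)" for k
      using fin unfolding findim_subspace_def by metis
    have "P k x \<in> span (\<Union>k<n. B k)" if "k < n" for k x
    proof -
      have "P k x \<in> span (B k)"
        using B(2) by blast
      also have "\<dots> \<subseteq> span (\<Union>k<n. B k)"
        using that by (intro span_mono) auto
      finally show ?thesis .
    qed
    then have "range (\<lambda>x. \<Sum>k<n. P k x) \<subseteq> span (\<Union>k<n. B k)"
      by (auto intro!: span_sum)
    moreover have "subspace (range (\<lambda>x. \<Sum>k<n. P k x))"
      using blQ by (intro linear_subspace_image bounded_linear.linear) auto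
    ultimately show ?thesis
      using B(1) by (intro findim_subspace_mono[of _ "\<Union>k<n. B k"]) auto
  qed
  ultimately show ?thesis
    using blQ sums unfolding fd_projections_def sums_def by (auto intro: bounded_linear.linear)
qed

lemma has_monotone_FDD_projections:
  assumes "has_monotone_FDD TYPE('x::real_normed_vector)"
  obtains Q :: "nat \<Rightarrow> 'x::real_normed_vector \<Rightarrow> 'x" where "fd_projections Q"
  using assms monotone_FDD_projections unfolding has_monotone_FDD_def by blast

context
  fixes Q :: "nat \<Rightarrow> 'x \<Rightarrow> 'x::real_normed_vector"
  assumes Q: "fd_projections Q"
begin

lemma fd_linear: "linear (Q n)"
  and fd_findim: "findim_subspace (range (Q n))"
  and fd_norm: "norm (Q n x) \<le> norm x"
  and fd_tendsto: "(\<lambda>n. Q n x) \<longlonglongrightarrow> x"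
  and fd_comp: "Q m (Q n x) = Q (min m n) x"
  using Q by (auto simp: fd_projections_def)

lemma fd_range: "x \<in> range (Q n) \<longleftrightarrow> Q n x = x"
  by (metis fd_comp min.idem rangeE rangeI)

lemma fd_range_mono: "m \<le> n \<Longrightarrow> x \<in> range (Q m) \<Longrightarrow> x \<in> range (Q n)"
  by (metis fd_comp fd_range min.absorb2)

text \<open>The lower bound \<open>M\<close> lets the back and forth push its indices to
  infinity.\<close>

lemma fd_uniformly_close:
  assumes V: "findim_subspace V" and f: "linear_map_on V f" and \<eta>: "\<eta> > 0"
  obtains n where "n \<ge> M" "\<And>x. x \<in> V \<Longrightarrow> norm (Q n (f x) - f x) \<le> \<eta> * norm x"
proof -
  have "\<forall>\<^sub>F n in sequentially. \<forall>x\<in>V. norm (Q n (f x) - f x) \<le> \<eta> * norm x"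
  proof (rule findim_tendsto_0_uniformly[OF V _ _ \<eta>])
    show "linear_map_on V (\<lambda>x. Q n (f x) - f x)" for n
      using f fd_linear[of n] by (simp add: linear_map_on_def linear_add linear_scale scaleR_diff_right)
    show "(\<lambda>n. Q n (f x) - f x) \<longlonglongrightarrow> 0" for x
      using fd_tendsto[of "f x"] by (simp add: LIM_zero)
  qed
  then have "\<forall>\<^sub>F n in sequentially. n \<ge> M \<and> (\<forall>x\<in>V. norm (Q n (f x) - f x) \<le> \<eta> * norm x)"
    using eventually_ge_at_top by (rule eventually_elim2) auto
  then show ?thesis
    using that unfolding eventually_sequentially by blast
qed

end

section \<open>Back and forth\<close>

text \<open>\<open>U\<close> is total but factors through \<open>q\<close>, so it carries only
  finite-dimensional data while limits can be taken on the whole space. The left inverse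
  \<open>s\<close> makes \<open>U\<close> nearly isometric on \<open>range q\<close> and serves as
  the map \<open>r\<close> of the next amalgamation.\<close>

definition almost_split ::
  "real \<Rightarrow> ('x::real_normed_vector \<Rightarrow> 'x) \<Rightarrow> ('x \<Rightarrow> 'y::real_normed_vector) \<Rightarrow> ('y \<Rightarrow> 'x) \<Rightarrow> bool" where
  "almost_split \<epsilon> q U s \<longleftrightarrow>
     one_bounded_on UNIV norm norm U \<and> (\<forall>x. U (q x) = U x) \<and>
     one_bounded_on UNIV norm norm s \<and> range s \<subseteq> range q \<and>
     (\<forall>x\<in>range q. norm (s (U x) - x) \<le> \<epsilon> * norm x)"

text \<open>Compressing \<open>U\<close> by a late \<open>R m\<close> lands in a finite-dimensional
  space and costs \<open>\<eta>\<close>; amalgamation then extends \<open>i\<close> along the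
  compressed map. A general \<open>i\<close> covers both the start, where it is the given isometry,
  and the later steps, where it is an inclusion.\<close>

lemma extend_to_projection:
  fixes V :: "'v::real_normed_vector set" and i :: "'v \<Rightarrow> 'x::real_normed_vector"
    and R :: "nat \<Rightarrow> 'w \<Rightarrow> 'w::real_normed_vector"
  assumes E: "property_E TYPE('x)" and R: "fd_projections R"
    and V: "findim_subspace V"
    and i: "linear_isometry_on V norm norm i" "one_complemented norm (i ` V) UNIV"
    and U: "one_bounded_on V norm norm U"
    and s: "one_bounded_on UNIV norm norm s" "range s \<subseteq> V"
    and sU: "\<And>x. x \<in> V \<Longrightarrow> norm (s (U x) - x) \<le> \<delta> * norm x"
    and \<delta>: "0 \<le> \<delta>" "0 < \<eta>" "\<delta> + \<eta> \<le> 1" and \<epsilon>: "0 < \<epsilon>" "\<epsilon> \<le> 1"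
  obtains m T t where "m \<ge> M" "almost_split \<epsilon> (R m) T t"
    "\<And>x. x \<in> V \<Longrightarrow> norm (R m (U x) - U x) \<le> \<eta> * norm x"
    "\<And>x. x \<in> V \<Longrightarrow> norm (T (U x) - i x) \<le> (\<delta> + \<eta> + \<epsilon>) * norm x"
proof -
  have Ul: "linear_map_on V U" "\<And>x. x \<in> V \<Longrightarrow> norm (U x) \<le> norm x"
    using U by (auto simp: one_bounded_on_def)
  have sl: "linear s" "\<And>y. norm (s y) \<le> norm y"
    using s by (auto simp: one_bounded_on_def linear_map_on_UNIV)
  obtain m where m: "m \<ge> M" "\<And>x. x \<in> V \<Longrightarrow> norm (R m (U x) - U x) \<le> \<eta> * norm x"
    using fd_uniformly_close[OF R V Ul(1) \<delta>(2)] by metis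
  have e: "one_bounded_on V norm norm (\<lambda>x. R m (U x))"
    using Ul fd_linear[OF R, of m] order_trans[OF fd_norm[OF R]]
    by (simp add: one_bounded_on_def linear_map_on_def linear_add linear_scale)
  have r: "one_bounded_on (range (R m)) norm norm s"
    using sl by (simp add: one_bounded_on_def linear_map_on_linear)
  have e': "(\<lambda>x. R m (U x)) ` V \<subseteq> range (R m)" and r': "s ` range (R m) \<subseteq> V"
    using s(2) by auto
  \<comment> \<open>The contraction \<open>s\<close> does not enlarge the compression error
    \<open>\<eta>\<close>, which adds to its own defect \<open>\<delta>\<close>.\<close>
  have re: "norm (s (R m (U x)) - x) \<le> (\<delta> + \<eta>) * norm x" if x: "x \<in> V" for x
  proof -
    have "norm (s (R m (U x) - U x)) \<le> \<eta> * norm x"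
      using sl(2) m(2)[OF x] order_trans by blast
    then have "norm (s (R m (U x)) - s (U x)) \<le> \<eta> * norm x"
      using sl(1) by (simp add: linear_diff)
    then show ?thesis
      using sU[OF x] norm_triangle_ineq[of "s (R m (U x)) - s (U x)" "s (U x) - x"]
      by (simp add: distrib_right)
  qed
  obtain f t where f: "one_bounded_on (range (R m)) norm norm f"
      and t: "one_bounded_on UNIV norm norm t" "range t \<subseteq> range (R m)"
      "\<And>y. y \<in> range (R m) \<Longrightarrow> norm (t (f y) - y) \<le> \<epsilon> * norm y"
      and fe: "\<And>x. x \<in> V \<Longrightarrow> norm (f (R m (U x)) - i x) \<le> (\<delta> + \<eta> + \<epsilon>) * norm x"
    by (rule property_E_amalgam[OF E V fd_findim[OF R] i e e' r r' re _ \<delta>(3) \<epsilon>]) (use \<delta> in auto)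
  \<comment> \<open>\<open>f\<close> is controlled on \<open>range (R m)\<close> only;
    precomposition with \<open>R m\<close> makes it a contraction of the whole space.\<close>
  have T: "one_bounded_on UNIV norm norm (\<lambda>y. f (R m y))"
    using f fd_linear[OF R, of m]
    by (auto simp: one_bounded_on_def linear_map_on_def linear_add linear_scale
        intro: order_trans[OF _ fd_norm[OF R]])
  have idem: "R m (R m y) = R m y" for y
    by (simp add: fd_comp[OF R])
  have "almost_split \<epsilon> (R m) (\<lambda>y. f (R m y)) t"
    using T t by (auto simp: almost_split_def idem)
  then show ?thesis
    using that[OF m(1) _ m(2) fe] by simp
qed

text \<open>The extended map is the inclusion of \<open>range (Q n)\<close>, so \<open>T\<close>
  nearly inverts \<open>U\<close>. The factor 3 collects the defect of \<open>s\<close>, the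
  compression error (chosen as \<open>\<delta>\<close> too) and
  \<open>\<epsilon> \<le> \<delta>\<close>.\<close>

lemma almost_split_step:
  fixes Q :: "nat \<Rightarrow> 'x \<Rightarrow> 'x::real_normed_vector" and R :: "nat \<Rightarrow> 'y \<Rightarrow> 'y::real_normed_vector"
  assumes E: "property_E TYPE('x)" and Q: "fd_projections Q" and R: "fd_projections R"
    and U: "almost_split \<delta> (Q n) U s"
    and \<delta>: "0 < \<delta>" "\<delta> \<le> 1 / 2" and \<epsilon>: "0 < \<epsilon>" "\<epsilon> \<le> \<delta>"
  obtains m T t where "m \<ge> M" "almost_split \<epsilon> (R m) T t"
    "\<And>x. x \<in> range (Q n) \<Longrightarrow> norm (R m (U x) - U x) \<le> \<delta> * norm x"
    "\<And>x. x \<in> range (Q n) \<Longrightarrow> norm (T (U x) - x) \<le> 3 * \<delta> * norm x"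
proof -
  let ?V = "range (Q n)"
  have V: "findim_subspace ?V"
    using fd_findim[OF Q] .
  have i: "linear_isometry_on ?V norm norm (\<lambda>x. x)"
    by (simp add: linear_isometry_on_def linear_map_on_def)
  have "one_complemented norm ?V UNIV"
    unfolding one_complemented_def one_bounded_on_def linear_map_on_UNIV
    using V fd_linear[OF Q] fd_norm[OF Q]
    by (auto simp: findim_subspace_def fd_comp[OF Q] intro!: exI[of _ "Q n"])
  then have iV: "one_complemented norm ((\<lambda>x. x) ` ?V) UNIV"
    by simp
  have U1: "one_bounded_on ?V norm norm U"
    using U by (auto simp: almost_split_def one_bounded_on_def linear_map_on_def)
  have s: "one_bounded_on UNIV norm norm s" "range s \<subseteq> ?V"
      "\<And>x. x \<in> ?V \<Longrightarrow> norm (s (U x) - x) \<le> \<delta> * norm x"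
    using U unfolding almost_split_def by blast+
  obtain m T t where m: "m \<ge> M" "almost_split \<epsilon> (R m) T t"
    "\<And>x. x \<in> ?V \<Longrightarrow> norm (R m (U x) - U x) \<le> \<delta> * norm x"
    "\<And>x. x \<in> ?V \<Longrightarrow> norm (T (U x) - x) \<le> (\<delta> + \<delta> + \<epsilon>) * norm x"
    by (rule extend_to_projection[OF E R V i iV U1 s, of \<delta> \<epsilon> M]) (use \<delta> \<epsilon> in auto)
  have "(\<delta> + \<delta> + \<epsilon>) * norm x \<le> 3 * \<delta> * norm x" for x :: 'x
    using \<epsilon> by (intro mult_right_mono) auto
  then show ?thesis
    using that[OF m(1,2,3)] m(4) order_trans by blast
qed

section \<open>Pointwise limits of contractions controlled on a dense increasing union\<close>

text \<open>On each \<open>X j\<close> the increments are summable from index \<open>j\<close> on,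
  so completeness gives convergence there. Uniform contractivity carries it from the dense union to
  every point.\<close>

lemma contractions_limit:
  fixes T :: "nat \<Rightarrow> 'x::real_normed_vector \<Rightarrow> 'y::banach" and X :: "nat \<Rightarrow> 'x set"
  assumes T: "\<And>k. one_bounded_on UNIV norm norm (T k)"
    and mono: "\<And>k. X k \<subseteq> X (Suc k)"
    and dense: "\<And>x e. e > 0 \<Longrightarrow> \<exists>k. \<exists>y\<in>X k. norm (x - y) < e"
    and c: "summable c"
    and step: "\<And>k x. x \<in> X k \<Longrightarrow> norm (T (Suc k) x - T k x) \<le> c k * norm x"
  shows "\<exists>H. one_bounded_on UNIV norm norm H \<and> (\<forall>x. (\<lambda>k. T k x) \<longlonglongrightarrow> H x) \<and>
    (\<forall>x\<in>X 0. norm (H x - T 0 x) \<le> suminf c * norm x)"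
proof -
  have Tl: "linear (T k)" and Tn: "norm (T k x) \<le> norm x" for k x
    using T[of k] by (auto simp: one_bounded_on_def linear_map_on_UNIV)
  have up: "x \<in> X j" if "x \<in> X i" "i \<le> j" for i j x
    using that lift_Suc_mono_le[of X i j] mono by blast
  have conv_X: "convergent (\<lambda>k. T k x)" if x: "x \<in> X j" for x j
  proof -
    have "summable (\<lambda>k. T (Suc k) x - T k x)"
      using step up[OF x] by (intro summable_comparison_test'[OF summable_mult2[OF c, of "norm x"], of j]) blast
    then have "convergent (\<lambda>n. T n x - T 0 x)"
      by (simp add: summable_iff_convergent sum_lessThan_telescope[where f = "\<lambda>k. T k x"])
    then show ?thesis
      by (simp add: convergent_diff_const_right_iff)
  qed
  have "Cauchy (\<lambda>k. T k x)" for x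
  proof (rule CauchyI)
    fix e :: real assume e: "e > 0"
    obtain j y where y: "y \<in> X j" "norm (x - y) < e / 3"
      using dense[of "e / 3" x] e by auto
    obtain M where M: "\<And>m n. m \<ge> M \<Longrightarrow> n \<ge> M \<Longrightarrow> norm (T m y - T n y) < e / 3"
      using CauchyD[OF convergent_Cauchy[OF conv_X[OF y(1)]], of "e / 3"] e by auto
    have d: "norm (T k x - T k y) < e / 3" for k
      using Tn[of k "x - y"] y(2) Tl[of k] by (simp add: linear_diff)
    have "norm (T m x - T n x) < e" if "m \<ge> M" "n \<ge> M" for m n
    proof -
      have "T m x - T n x = (T m x - T m y) + (T m y - T n y) - (T n x - T n y)"
        by simp
      also have "norm \<dots> \<le> norm (T m x - T m y) + norm (T m y - T n y) + norm (T n x - T n y)"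
        using norm_triangle_ineq4 norm_triangle_ineq add_right_mono order_trans by blast
      also have "\<dots> < e"
        using d[of m] d[of n] M[OF that] by simp
      finally show ?thesis .
    qed
    then show "\<exists>M. \<forall>m\<ge>M. \<forall>n\<ge>M. norm (T m x - T n x) < e"
      by blast
  qed
  then obtain H where H: "\<And>x. (\<lambda>k. T k x) \<longlonglongrightarrow> H x"
    unfolding Cauchy_convergent_iff convergent_def by metis
  show ?thesis
  proof (intro exI[of _ H] conjI allI ballI H)
    have "linear H"
    proof (rule linearI)
      show "H (x + y) = H x + H y" for x y
        using LIMSEQ_unique[OF H[of "x + y"]] tendsto_add[OF H[of x] H[of y]] Tl
        by (simp add: linear_add)
      show "H (a *\<^sub>R x) = a *\<^sub>R H x" for a x
        using LIMSEQ_unique[OF H[of "a *\<^sub>R x"]] tendsto_scaleR[OF tendsto_const H[of x], of a] Tl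
        by (simp add: linear_scale)
    qed
    moreover have "norm (H x) \<le> norm x" for x
      using LIMSEQ_le_const2[OF tendsto_norm[OF H[of x]]] Tn by blast
    ultimately show "one_bounded_on UNIV norm norm H"
      by (simp add: one_bounded_on_def linear_map_on_UNIV)
    show "norm (H x - T 0 x) \<le> suminf c * norm x" if x: "x \<in> X 0" for x
    proof -
      have xk: "x \<in> X k" for k
        using up[OF x] by simp
      \<comment> \<open>A point of \<open>X 0\<close> lies in every \<open>X k\<close>, so all terms
        of the telescoping series are controlled.\<close>
      have 1: "(\<lambda>k. T (Suc k) x - T k x) sums (H x - T 0 x)"
        using telescope_sums[OF H] .
      have 2: "(\<lambda>k. c k * norm x) sums (suminf c * norm x)"
        using sums_mult2[OF summable_sums[OF c]] .
      show ?thesis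
        using norm_suminf_le[OF step[OF xk] sums_summable[OF 2]] sums_unique[OF 1] sums_unique[OF 2]
        by simp
    qed
  qed
qed

text \<open>Since the \<open>S k\<close> are contractions, \<open>S k (T k x)\<close> and
  \<open>S k (H x)\<close> have the same limit. The former tends to \<open>x\<close> on the dense
  union, the latter to \<open>G (H x)\<close>; contractivity of \<open>G\<close> and
  \<open>H\<close> extends the identity to all points.\<close>

lemma contractions_limit_inverse:
  fixes S :: "nat \<Rightarrow> 'y::real_normed_vector \<Rightarrow> 'x::real_normed_vector"
    and T :: "nat \<Rightarrow> 'x \<Rightarrow> 'y" and X :: "nat \<Rightarrow> 'x set"
  assumes S: "\<And>k. one_bounded_on UNIV norm norm (S k)"
    and G: "one_bounded_on UNIV norm norm G" "\<And>y. (\<lambda>k. S k y) \<longlonglongrightarrow> G y"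
    and H: "one_bounded_on UNIV norm norm H" "\<And>x. (\<lambda>k. T k x) \<longlonglongrightarrow> H x"
    and mono: "\<And>k. X k \<subseteq> X (Suc k)"
    and dense: "\<And>x e. e > 0 \<Longrightarrow> \<exists>k. \<exists>y\<in>X k. norm (x - y) < e"
    and c: "c \<longlonglongrightarrow> 0"
    and ST: "\<And>k x. x \<in> X k \<Longrightarrow> norm (S k (T k x) - x) \<le> c k * norm x"
  shows "G (H x) = x"
proof -
  have Sl: "linear (S k)" and Sn: "norm (S k y) \<le> norm y" for k y
    using S[of k] by (auto simp: one_bounded_on_def linear_map_on_UNIV)
  have Gl: "linear G" "\<And>y. norm (G y) \<le> norm y" and Hl: "linear H" "\<And>x. norm (H x) \<le> norm x"
    using G(1) H(1) by (auto simp: one_bounded_on_def linear_map_on_UNIV)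
  have on_X: "G (H x) = x" if x: "x \<in> X j" for x j
  proof -
    have lim: "(\<lambda>k. norm (T k x - H x)) \<longlonglongrightarrow> 0"
      using H(2)[of x] by (simp add: LIM_zero tendsto_norm_zero)
    have le: "norm (S k (T k x) - S k (H x)) \<le> norm (T k x - H x)" for k
      using Sn[of k "T k x - H x"] Sl by (simp add: linear_diff)
    have "(\<lambda>k. S k (T k x) - S k (H x)) \<longlonglongrightarrow> 0"
      by (rule Lim_null_comparison[OF always_eventually[OF allI[OF le]] lim])
    from tendsto_add[OF this G(2)[of "H x"]] have 1: "(\<lambda>k. S k (T k x)) \<longlonglongrightarrow> G (H x)"
      by simp
    have "\<forall>\<^sub>F k in sequentially. norm (S k (T k x) - x) \<le> c k * norm x"
      using eventually_ge_at_top[of j]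
    proof (rule eventually_mono)
      fix k assume "j \<le> k"
      then have "x \<in> X k"
        using x lift_Suc_mono_le[of X j k] mono by blast
      then show "norm (S k (T k x) - x) \<le> c k * norm x"
        by (rule ST)
    qed
    moreover have "(\<lambda>k. c k * norm x) \<longlonglongrightarrow> 0"
      using tendsto_mult[OF c tendsto_const[of "norm x"]] by simp
    ultimately have "(\<lambda>k. S k (T k x) - x) \<longlonglongrightarrow> 0"
      by (rule Lim_null_comparison)
    then have "(\<lambda>k. S k (T k x)) \<longlonglongrightarrow> x"
      by (rule LIM_zero_cancel)
    with 1 show ?thesis
      by (rule LIMSEQ_unique)
  qed
  have "norm (G (H x) - x) \<le> e" if e: "e > 0" for e
  proof -
    obtain j y where y: "y \<in> X j" "norm (x - y) < e / 2"
      using dense[of "e / 2" x] e by auto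
    have "G (H x) - x = G (H (x - y)) - (x - y)"
      using Gl(1) Hl(1) on_X[OF y(1)] by (simp add: linear_diff)
    also have "norm \<dots> \<le> norm (G (H (x - y))) + norm (x - y)"
      by (rule norm_triangle_ineq4)
    also have "norm (G (H (x - y))) \<le> norm (x - y)"
      using Gl(2) Hl(2) order_trans by blast
    finally show ?thesis
      using y(2) by simp
  qed
  then have "norm (G (H x) - x) \<le> 0"
    by (rule field_le_epsilon) simp
  then show ?thesis
    by simp
qed

section \<open>Consecutive maps of the zigzag and the limiting isometry\<close>

lemma norm_add_diff_le:
  fixes a b c :: "'a::real_normed_vector"
  shows "norm (a + b - c) \<le> norm a + norm b + norm c"
  using norm_triangle_ineq4[of "a + b" c] norm_triangle_ineq[of a b] by simp

text \<open>Going from \<open>S' x\<close> to \<open>S' (T (S x))\<close>, then to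
  \<open>q (S x)\<close> and to \<open>S x\<close> costs \<open>3 * d\<close>, \<open>3 * d\<close>
  and \<open>d\<close>. The detour through \<open>q\<close> is made because \<open>S x\<close> may
  lie outside \<open>range q\<close>, where alone \<open>S'\<close> is known to invert
  \<open>T\<close>; it is harmless as \<open>T\<close> factors through \<open>q\<close>.\<close>

lemma zigzag_close:
  fixes S S' :: "'x::real_normed_vector \<Rightarrow> 'y::real_normed_vector"
  assumes S: "one_bounded_on UNIV norm norm S" and S': "one_bounded_on UNIV norm norm S'"
    and T: "\<And>y. T (q y) = T y" and q: "\<And>y. norm (q y) \<le> norm y"
    and d: "0 \<le> d"
    and TS: "norm (T (S x) - x) \<le> 3 * d * norm x"
    and qS: "norm (q (S x) - S x) \<le> d * norm x"
    and S'T: "\<And>y. y \<in> range q \<Longrightarrow> norm (S' (T y) - y) \<le> 3 * d * norm y"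
  shows "norm (S' x - S x) \<le> 7 * d * norm x"
proof -
  have S'l: "linear S'" "\<And>z. norm (S' z) \<le> norm z" and Sn: "norm (S x) \<le> norm x"
    using S S' by (auto simp: one_bounded_on_def linear_map_on_UNIV)
  have "norm (S' (T (S x)) - S' x) \<le> 3 * d * norm x"
    using S'l(2)[of "T (S x) - x"] TS S'l(1) by (simp add: linear_diff)
  moreover have "norm (S' (T (S x)) - q (S x)) \<le> 3 * d * norm x"
  proof -
    have "norm (S' (T (S x)) - q (S x)) \<le> 3 * d * norm (q (S x))"
      using S'T[of "q (S x)"] by (simp add: T)
    also have "\<dots> \<le> 3 * d * norm x"
      using d order_trans[OF q[of "S x"] Sn] by (intro mult_left_mono) auto
    finally show ?thesis .
  qed
  moreover have "S' x - S x
      = (q (S x) - S x) + (S' (T (S x)) - q (S x)) - (S' (T (S x)) - S' x)"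
    by simp
  then have "norm (S' x - S x)
      \<le> norm (q (S x) - S x) + norm (S' (T (S x)) - q (S x)) + norm (S' (T (S x)) - S' x)"
    by (simp only: norm_add_diff_le)
  ultimately show ?thesis
    using qS by simp
qed

lemma fd_ranges_dense:
  assumes Q: "fd_projections Q" and n: "\<And>k. k \<le> n k" and e: "e > 0"
  shows "\<exists>k. \<exists>y\<in>range (Q (n k)). norm (x - y) < e"
proof -
  obtain j where "norm (Q j x - x) < e"
    using LIMSEQ_D[OF fd_tendsto[OF Q] e] by blast
  moreover have "Q j x \<in> range (Q (n j))"
    using fd_range_mono[OF Q n] by blast
  ultimately show ?thesis
    by (metis norm_minus_commute)
qed

lemma back_and_forth:
  fixes Q :: "nat \<Rightarrow> 'p \<Rightarrow> 'p::banach" and R :: "nat \<Rightarrow> 'k \<Rightarrow> 'k::banach"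
    and U0 :: "'p \<Rightarrow> 'k"
  assumes EP: "property_E TYPE('p)" and EK: "property_E TYPE('k)"
    and Q: "fd_projections Q" and R: "fd_projections R"
    and U0: "almost_split \<eta> (Q n0) U0 s0" and \<eta>: "0 < \<eta>" "\<eta> \<le> 1 / 2"
  obtains H where "linear_isometry_on UNIV norm norm H" "bij H"
    "\<And>x. x \<in> range (Q n0) \<Longrightarrow> norm (H x - U0 x) \<le> 14 * \<eta> * norm x"
proof -
  \<comment> \<open>Halving the errors makes the drifts \<open>7 * d k\<close> sum to
    \<open>14 * \<eta>\<close>.\<close>
  define d where "d k = \<eta> / 2 ^ k" for k :: nat
  have d: "0 < d k" "d k \<le> 1 / 2" "d (Suc k) \<le> d k" for k
  proof -
    show "0 < d k" "d (Suc k) \<le> d k"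
      using \<eta>(1) by (simp_all add: d_def field_simps)
    have "d k \<le> \<eta>"
      using \<eta>(1) one_le_power[of "2::real" k] by (simp add: d_def divide_le_eq mult_le_cancel_left1)
    then show "d k \<le> 1 / 2"
      using \<eta>(2) by simp
  qed
  \<comment> \<open>A stage holds a forward map \<open>U\<close> and a backward map \<open>V\<close>
    nearly inverting it. The bounds by \<open>k\<close> make the ranges exhaust both spaces, and the
    last clause anchors the sequence at \<open>U0\<close>.\<close>
  define stage where "stage k = (\<lambda>(n :: nat, U :: 'p \<Rightarrow> 'k, m :: nat, V :: 'k \<Rightarrow> 'p).
      k \<le> n \<and> k \<le> m \<and> (\<exists>s. almost_split (d k) (Q n) U s) \<and> (\<exists>t. almost_split (d k) (R m) V t) \<and>
      (\<forall>x\<in>range (Q n). norm (R m (U x) - U x) \<le> d k * norm x \<and>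
         norm (V (U x) - x) \<le> 3 * d k * norm x) \<and>
      (k = 0 \<longrightarrow> n = n0 \<and> U = U0))" for k :: nat
  \<comment> \<open>Between stages it is the next forward map that nearly inverts the present
    \<open>V\<close>.\<close>
  define link where "link k = (\<lambda>(n :: nat, U :: 'p \<Rightarrow> 'k, m :: nat, V :: 'k \<Rightarrow> 'p)
      (n' :: nat, U' :: 'p \<Rightarrow> 'k, m' :: nat, V' :: 'k \<Rightarrow> 'p).
      n \<le> n' \<and> m \<le> m' \<and>
      (\<forall>y\<in>range (R m). norm (Q n' (V y) - V y) \<le> d k * norm y \<and>
         norm (U' (V y) - y) \<le> 3 * d k * norm y))" for k :: nat
  have "\<exists>st. stage 0 st"
  proof -
    have U0': "almost_split (d 0) (Q n0) U0 s0"
      using U0 by (simp add: d_def)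
    obtain m V t where V: "m \<ge> 0" "almost_split (d 0) (R m) V t"
      "\<And>x. x \<in> range (Q n0) \<Longrightarrow> norm (R m (U0 x) - U0 x) \<le> d 0 * norm x"
      "\<And>x. x \<in> range (Q n0) \<Longrightarrow> norm (V (U0 x) - x) \<le> 3 * d 0 * norm x"
      using almost_split_step[OF EP Q R U0' d(1,2) d(1) order_refl, of 0] by metis
    have "stage 0 (n0, U0, m, V)"
      using U0' V le0 unfolding stage_def prod.case by blast
    then show ?thesis
      by blast
  qed
  moreover have "\<exists>st'. stage (Suc k) st' \<and> link k st st'" if st_k: "stage k st" for k st
  proof -
    obtain n U m V where st: "st = (n, U, m, V)"
      by (metis prod_cases4)
    obtain t where t: "almost_split (d k) (R m) V t"
      using st_k unfolding stage_def st prod.case by blast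
    \<comment> \<open>The error parameter drops from \<open>d k\<close> to \<open>d (Suc k)\<close>
      when \<open>V\<close> is answered by \<open>U'\<close>; it stays the same when
      \<open>U'\<close> is answered by \<open>V'\<close>.\<close>
    obtain n' U' s where U': "n' \<ge> max n (Suc k)" "almost_split (d (Suc k)) (Q n') U' s"
      "\<And>y. y \<in> range (R m) \<Longrightarrow> norm (Q n' (V y) - V y) \<le> d k * norm y"
      "\<And>y. y \<in> range (R m) \<Longrightarrow> norm (U' (V y) - y) \<le> 3 * d k * norm y"
      using almost_split_step[OF EK R Q t d(1,2) d(1,3), of "max n (Suc k)"] by metis
    obtain m' V' t' where V': "m' \<ge> max m (Suc k)" "almost_split (d (Suc k)) (R m') V' t'"
      "\<And>x. x \<in> range (Q n') \<Longrightarrow> norm (R m' (U' x) - U' x) \<le> d (Suc k) * norm x"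
      "\<And>x. x \<in> range (Q n') \<Longrightarrow> norm (V' (U' x) - x) \<le> 3 * d (Suc k) * norm x"
      using almost_split_step[OF EP Q R U'(2) d(1,2) d(1) order_refl, of "max m (Suc k)"] by metis
    have "stage (Suc k) (n', U', m', V')"
      using U'(1,2) V' nat.distinct(2) unfolding stage_def prod.case max.bounded_iff by blast
    moreover have "link k st (n', U', m', V')"
      using U' V'(1) unfolding link_def st prod.case max.bounded_iff by blast
    ultimately show ?thesis
      by blast
  qed
  ultimately obtain F where F: "\<And>k. stage k (F k)" "\<And>k. link k (F k) (F (Suc k))"
    using dependent_nat_choice[of stage link] by metis
  define n U m V where "n k = fst (F k)" and "U k = fst (snd (F k))"
    and "m k = fst (snd (snd (F k)))" and "V k = snd (snd (snd (F k)))" for k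
  have F_eq: "F k = (n k, U k, m k, V k)" for k
    by (simp add: n_def U_def m_def V_def)
  have nm: "k \<le> n k" "k \<le> m k" "n 0 = n0" "U 0 = U0" for k
    using F(1)[of k] F(1)[of 0] unfolding stage_def F_eq prod.case by blast+
  have spU: "one_bounded_on UNIV norm norm (U k)" "U k (Q (n k) x) = U k x"
    and spV: "one_bounded_on UNIV norm norm (V k)" "V k (R (m k) y) = V k y" for k x y
    using F(1)[of k] unfolding stage_def F_eq prod.case almost_split_def by blast+
  have RU: "norm (R (m k) (U k x) - U k x) \<le> d k * norm x"
    and VU: "norm (V k (U k x) - x) \<le> 3 * d k * norm x" if "x \<in> range (Q (n k))" for k x
    using F(1)[of k] that unfolding stage_def F_eq prod.case by blast+
  have QV: "norm (Q (n (Suc k)) (V k y) - V k y) \<le> d k * norm y"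
    and UV: "norm (U (Suc k) (V k y) - y) \<le> 3 * d k * norm y" if "y \<in> range (R (m k))" for k y
    using F(2)[of k] that unfolding link_def F_eq prod.case by blast+
  have mono: "n k \<le> n (Suc k)" "m k \<le> m (Suc k)" for k
    using F(2)[of k] unfolding link_def F_eq prod.case by blast+
  have monoX: "range (Q (n k)) \<subseteq> range (Q (n (Suc k)))" "range (R (m k)) \<subseteq> range (R (m (Suc k)))" for k
    using fd_range_mono[OF Q mono(1)] fd_range_mono[OF R mono(2)] by blast+
  have U_close: "norm (U (Suc k) x - U k x) \<le> 7 * d k * norm x" if x: "x \<in> range (Q (n k))" for k x
    by (rule zigzag_close[OF spU(1) spU(1) spV(2) fd_norm[OF R] less_imp_le[OF d(1)]
          VU[OF x] RU[OF x] UV])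
  \<comment> \<open>\<open>V k\<close> and \<open>V (Suc k)\<close> are compared through
    \<open>U (Suc k)\<close>, so the later, smaller error is weakened to the common
    \<open>d k\<close>.\<close>
  have VU': "norm (V (Suc k) (U (Suc k) x) - x) \<le> 3 * d k * norm x"
    if x: "x \<in> range (Q (n (Suc k)))" for k x
  proof -
    have "3 * d (Suc k) * norm x \<le> 3 * d k * norm x"
      using d(3) by (intro mult_right_mono) auto
    then show ?thesis
      using VU[OF x] by linarith
  qed
  have V_close: "norm (V (Suc k) y - V k y) \<le> 7 * d k * norm y" if y: "y \<in> range (R (m k))" for k y
    by (rule zigzag_close[OF spV(1) spV(1) spU(2) fd_norm[OF Q] less_imp_le[OF d(1)]
          UV[OF y] QV[OF y] VU'])
  have d_sums: "(\<lambda>k. 7 * d k) sums (14 * \<eta>)"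
  proof -
    have "14 * \<eta> * (1 / 2) ^ Suc k = 7 * d k" for k
      unfolding d_def power_Suc power_one_over by simp
    then show ?thesis
      using sums_mult[OF power_half_series, of "14 * \<eta>"] by (simp only: mult_1_right)
  qed
  note denseQ = fd_ranges_dense[OF Q nm(1)] and denseR = fd_ranges_dense[OF R nm(2)]
  obtain H where H: "one_bounded_on UNIV norm norm H" "\<And>x. (\<lambda>k. U k x) \<longlonglongrightarrow> H x"
    "\<And>x. x \<in> range (Q (n 0)) \<Longrightarrow> norm (H x - U 0 x) \<le> suminf (\<lambda>k. 7 * d k) * norm x"
    using contractions_limit[OF spU(1) monoX(1) denseQ sums_summable[OF d_sums] U_close] by blast
  obtain G where G: "one_bounded_on UNIV norm norm G" "\<And>y. (\<lambda>k. V k y) \<longlonglongrightarrow> G y"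
    using contractions_limit[OF spV(1) monoX(2) denseR sums_summable[OF d_sums] V_close] by blast
  have "d \<longlonglongrightarrow> 0"
    using tendsto_mult[OF tendsto_const[of "1 / 7"] summable_LIMSEQ_zero[OF sums_summable[OF d_sums]]]
    by simp
  then have d3: "(\<lambda>k. 3 * d k) \<longlonglongrightarrow> 0"
    using tendsto_mult[OF tendsto_const[of 3]] by fastforce
  have GH: "G (H x) = x" for x
    using contractions_limit_inverse[OF spV(1) G H(1,2) monoX(1) denseQ d3 VU] .
  \<comment> \<open>\<open>V k\<close> is inverted by \<open>U (Suc k)\<close>, hence the shifted
    sequence of forward maps.\<close>
  have HG: "H (G y) = y" for y
    using contractions_limit_inverse[OF spU(1) H(1) LIMSEQ_Suc[OF H(2)] G monoX(2) denseR d3 UV] .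
  show ?thesis
  proof (rule that)
    have "norm (H x) = norm x" for x
    proof (rule antisym)
      show "norm (H x) \<le> norm x"
        using H(1) by (simp add: one_bounded_on_def)
      have "norm (G (H x)) \<le> norm (H x)"
        using G(1) by (simp add: one_bounded_on_def)
      then show "norm x \<le> norm (H x)"
        by (simp add: GH)
    qed
    then show "linear_isometry_on UNIV norm norm H"
      using H(1) by (simp add: linear_isometry_on_def one_bounded_on_def)
    show "bij H"
      by (rule bij_betw_byWitness[where f' = G]) (simp_all add: GH HG)
    show "norm (H x - U0 x) \<le> 14 * \<eta> * norm x" if "x \<in> range (Q n0)" for x
      using H(3) that by (simp add: nm sums_unique[OF d_sums, symmetric])
  qed
qed

section \<open>Starting the back and forth at the given isometry\<close>

theorem theorem7p3:
  assumes "has_monotone_FDD TYPE('p::banach)" and "property_E TYPE('p)"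
    and "has_monotone_FDD TYPE('k::banach)" and "property_E TYPE('k)"
  shows "(\<forall>(A :: 'p set) (B :: 'k set) h.
            findim_subspace A \<and> one_complemented norm A UNIV \<and>
            findim_subspace B \<and> one_complemented norm B UNIV \<and>
            linear_isometry_on A norm norm h \<and> bij_betw h A B \<longrightarrow>
            (\<forall>\<epsilon>>0. \<exists>H :: 'p \<Rightarrow> 'k.
               linear_isometry_on UNIV norm norm H \<and> bij H \<and>
               onorm_on A norm (\<lambda>x. H x - h x) \<le> \<epsilon>)) \<and>
         (\<exists>H :: 'p \<Rightarrow> 'k. linear_isometry_on UNIV norm norm H \<and> bij H)"
proof -
  obtain Q :: "nat \<Rightarrow> 'p \<Rightarrow> 'p" where Q: "fd_projections Q"
    using has_monotone_FDD_projections[OF assms(1)] .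
  obtain R :: "nat \<Rightarrow> 'k \<Rightarrow> 'k" where R: "fd_projections R"
    using has_monotone_FDD_projections[OF assms(3)] .
  have main: "\<exists>H :: 'p \<Rightarrow> 'k. linear_isometry_on UNIV norm norm H \<and> bij H \<and>
      onorm_on A norm (\<lambda>x. H x - h x) \<le> \<epsilon>"
    if A: "findim_subspace A" "one_complemented norm A UNIV"
      and B: "one_complemented norm B UNIV"
      and h: "linear_isometry_on A norm norm h" "bij_betw h A B" and \<epsilon>: "\<epsilon> > 0"
    for A :: "'p set" and B :: "'k set" and h and \<epsilon> :: real
  proof -
    \<comment> \<open>The 17 is the sum of 14 from the back and forth, 2 from \<open>U\<close>
      against \<open>h\<close>, and 1 from replacing \<open>x\<close> by
      \<open>Q n x\<close>.\<close>
    define \<eta> where "\<eta> = min \<epsilon> 1 / 17"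
    have \<eta>: "0 < \<eta>" "\<eta> \<le> 1 / 2" "\<eta> \<le> 1" "0 + \<eta> \<le> 1" "17 * \<eta> \<le> \<epsilon>"
      using \<epsilon> by (auto simp: \<eta>_def)
    have hA: "one_complemented norm (h ` A) UNIV"
      using B h(2) by (simp add: bij_betw_def)
    obtain p where p: "one_bounded_on UNIV norm norm p" "range p \<subseteq> A" "\<And>x. x \<in> A \<Longrightarrow> p x = x"
      using A(2) unfolding one_complemented_def by blast
    have id: "one_bounded_on A norm norm (\<lambda>x. x)"
      by (simp add: one_bounded_on_def linear_map_on_def)
    have pid: "norm (p x - x) \<le> 0 * norm x" if "x \<in> A" for x
      using p(3)[OF that] by simp
    \<comment> \<open>The identity of \<open>A\<close> is exactly split by the projection
      \<open>p\<close>, so the defect is 0. Extending \<open>h\<close> along it moves the data from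
      \<open>A\<close> to a nearby \<open>range (Q n)\<close>.\<close>
    have "\<exists>n U s. almost_split \<eta> (Q n) U s \<and> (\<forall>x\<in>A. norm (Q n x - x) \<le> \<eta> * norm x) \<and>
        (\<forall>x\<in>A. norm (U x - h x) \<le> (0 + \<eta> + \<eta>) * norm x)"
      by (rule extend_to_projection[OF assms(4) Q A(1) h(1) hA id p(1,2) pid order_refl \<eta>(1,4,1,3)])
        blast+
    then obtain n U s where U: "almost_split \<eta> (Q n) U s"
      "\<And>x. x \<in> A \<Longrightarrow> norm (Q n x - x) \<le> \<eta> * norm x"
      "\<And>x. x \<in> A \<Longrightarrow> norm (U x - h x) \<le> (0 + \<eta> + \<eta>) * norm x"
      by blast
    obtain H where H: "linear_isometry_on UNIV norm norm H" "bij H"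
      "\<And>x. x \<in> range (Q n) \<Longrightarrow> norm (H x - U x) \<le> 14 * \<eta> * norm x"
      using back_and_forth[OF assms(2,4) Q R U(1) \<eta>(1,2)] by metis
    have Hl: "linear H" "\<And>x. norm (H x) = norm x"
      using H(1) by (auto simp: linear_isometry_on_def linear_map_on_UNIV)
    \<comment> \<open>\<open>A\<close> need not lie in \<open>range (Q n)\<close>, so
      \<open>H\<close> and \<open>U\<close> are compared at \<open>Q n x\<close>, where
      \<open>U (Q n x) = U x\<close>.\<close>
    have close: "norm (H x - h x) \<le> \<epsilon> * norm x" if x: "x \<in> A" for x
    proof -
      have 1: "norm (H (Q n x) - H x) \<le> \<eta> * norm x"
        using Hl(2)[of "Q n x - x"] U(2)[OF x] Hl(1) by (simp add: linear_diff)
      have "norm (H (Q n x) - U (Q n x)) \<le> 14 * \<eta> * norm (Q n x)"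
        by (rule H(3)) simp
      also have "\<dots> \<le> 14 * \<eta> * norm x"
        using fd_norm[OF Q] \<eta>(1) by (intro mult_left_mono) auto
      finally have 2: "norm (H (Q n x) - U x) \<le> 14 * \<eta> * norm x"
        using U(1) by (simp add: almost_split_def)
      have "H x - h x = (H (Q n x) - U x) + (U x - h x) - (H (Q n x) - H x)"
        by simp
      then have "norm (H x - h x)
          \<le> norm (H (Q n x) - U x) + norm (U x - h x) + norm (H (Q n x) - H x)"
        by (simp only: norm_add_diff_le)
      also have "\<dots> \<le> 17 * \<eta> * norm x"
        using 1 2 U(3)[OF x] by (simp add: algebra_simps)
      also have "\<dots> \<le> \<epsilon> * norm x"
        using \<eta>(5) by (intro mult_right_mono) auto
      finally show ?thesis .
    qed
    have "norm_on A norm"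
      by (simp add: norm_on_def norm_triangle_ineq)
    moreover have "0 \<in> A"
      using A(1) by (auto simp: findim_subspace_def span_zero)
    ultimately have "onorm_on A norm (\<lambda>x. H x - h x) \<le> \<epsilon>"
      using onorm_on_bound(1)[of A norm "\<lambda>x. H x - h x", OF _ close less_imp_le[OF \<epsilon>]] by blast
    then show ?thesis
      using H(1,2) by blast
  qed
  \<comment> \<open>The zero map between the zero subspaces is an admissible start, which yields an
    isometry of the whole spaces.\<close>
  have zero: "findim_subspace {0::'p}" "linear_isometry_on {0::'p} norm norm (\<lambda>_. 0::'k)"
    "bij_betw (\<lambda>_. 0::'k) {0::'p} {0}"
    by (auto simp: findim_subspace_def linear_isometry_on_def linear_map_on_def intro: exI[of _ "{}"])
  have "one_complemented norm {0::'p} UNIV" "one_complemented norm {0::'k} UNIV"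
    by (auto simp: one_complemented_def one_bounded_on_def linear_map_on_def intro!: exI[of _ "\<lambda>_. 0"])
  from main[OF zero(1) this zero(2,3) zero_less_one]
  have "\<exists>H :: 'p \<Rightarrow> 'k. linear_isometry_on UNIV norm norm H \<and> bij H"
    by blast
  with main show ?thesis
    by blast
qed

end
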